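(* Let $\mathcal H$ be a finite-dimensional real Hilbert space, $\mathcal X\subset\mathcal H$ a nonempty open convex set, $c(x,y)=\|x-y\|_{\mathcal H}^2$, and let $\rho\in\mathcal P(\mathcal X)$ satisfy $\rho\ll\mathcal L_{\mathcal H}$ and $\int_{\mathcal X}\|x\|_{\mathcal H}^2\,d\rho(x)<\infty$. Let $G$ be a Lie group acting smoothly on $\mathcal X$ via $\alpha:G\to\mathrm{Diff}(\mathcal X)$, and suppose the action is induced by an affine representation on $\mathcal H$ with associated maps $b:G\to\mathcal H$ and $\pi:G\to\mathrm{GL}(\mathcal H)$. Let $g_0,g_1\in G$ and $\mu_i=\alpha(g_i)_\#\rho$, $i=0,1$. Set $L=\pi(G)\subseteq\mathrm{GL}(\mathcal H)$ and assume that $(L,\theta)$ admits a global Cartan decomposition, with $\mathrm{Lie}(L)=\mathfrak k\oplus\mathfrak p$. Assume further that (i) every $S\in\mathfrak p$ is self-adjoint on $\mathcal H$; (ii) $L^\theta\subseteq\pi(\mathrm{Stab}_G(\rho))$. Then there exists $h\in\mathrm{Stab}_G(\rho)$, with $\pi(h)\in L^\theta$, such that: (a) $\pi(g_1hg_0^{-1})$ is self-adjoint and positive definite on $\mathcal H$; (b) $T_h=\alpha(g_1hg_0^{-1})$ solves the Monge problem between $\mu_0$ and $\mu_1$, and is the unique optimal Monge map up to $\mu_0$-almost everywhere equality; (c) $(\mathrm{id}_{\mathcal X},T_h)_\#\mu_0$ solves the Kantorovich problem between $\mu_0$ and $\mu_1$, and is the unique optimal Kantorovich plan; (d) $h$ solves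 the Lie group orbit transport problem defining $\mathds J_c(g_0,g_1)$, i.e. $h$ attains its infimum; (e) $\mathds K_c(\mu_0,\mu_1)=\mathds M_c(\mu_0,\mu_1)=\mathds J_c(g_0,g_1)$.
   Context: $\mathcal P(\mathcal X)$ is the set of Borel probability measures on $\mathcal X$; $\mathcal L_{\mathcal H}$ is the Lebesgue measure on $\mathcal H$ induced by the Hilbert structure; $T_\#\mu(A)=\mu(T^{-1}(A))$. $\mathrm{GL}(\mathcal H)$ is the group of invertible linear maps of $\mathcal H$. The smooth action is given by a group homomorphism $\alpha:G\to\mathrm{Diff}(\mathcal X)$ such that $(g,x)\mapsto\alpha(g)(x)$ is smooth. It is induced by an affine representation on $\mathcal H$ if there are maps $b:G\to\mathcal H$, $\pi:G\to\mathrm{GL}(\mathcal H)$ with $\alpha(g)(x)=b(g)+\pi(g)x\in\mathcal X$ for all $g\in G$, $x\in\mathcal X$, and $\pi(g_1g_2)=\pi(g_1)\pi(g_2)$, $b(g_1g_2)=b(g_1)+\pi(g_1)b(g_2)$ for all $g_1,g_2\in G$. $\mathrm{Stab}_G(\rho)=\{h\in G:\alpha(h)_\#\rho=\rho\}$. Global Cartan decomposition: let $L\subseteq\mathrm{GL}(\mathcal H)$ be a Lie subgroup and $\theta:L\to L$ a Lie group involution (a smooth automorphism with $\theta^2=\mathrm{id}_L$), with differential $d\theta_e$ at the identity. Put $\mathfrak l=\mathrm{Lie}(L)$, $\mathfrak k=\{X\in\mathfrak l:d\theta_e(X)=X\}$, $\mathfrak p=\{X\in\mathfrak l:d\theta_e(X)=-X\}$,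 $L^\theta=\{\ell\in L:\theta(\ell)=\ell\}$. Then $(L,\theta)$ admits a global Cartan decomposition if the map $L^\theta\times\mathfrak p\to L$, $(k,S)\mapsto k\exp(S)$, is a diffeomorphism. Monge problem: $\mathds M_c(\mu_0,\mu_1)=\inf_{T}\int_{\mathcal X}c(x,T(x))\,d\mu_0(x)$ over Borel maps $T:\mathcal X\to\mathcal X$ with $T_\#\mu_0=\mu_1$. Kantorovich problem: $\mathds K_c(\mu_0,\mu_1)=\inf_{\Gamma\in\Pi(\mu_0,\mu_1)}\int c\,d\Gamma$, where $\Pi(\mu_0,\mu_1)$ is the set of probability measures on $\mathcal X\times\mathcal X$ with marginals $\mu_0,\mu_1$. Lie group orbit transport problem: $\mathds J_c(g_0,g_1)=\inf_{h\in\mathrm{Stab}_G(\rho)}\int_{\mathcal X}c(\alpha(g_0)(x),\alpha(g_1h)(x))\,d\rho(x)$. *)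

theory Defs
  imports "HOL-Analysis.Analysis" "HOL-Probability.Probability" "HOL-Algebra.Group"
begin

section \<open>Smooth maps between normed spaces\<close>

(* For open S in a finite-dimensional space this is the usual class C^k: f is C^(k+1) iff f is
   differentiable and all its directional derivatives are C^k. *)
primrec Ck_on :: "nat \<Rightarrow> 'a::real_normed_vector set \<Rightarrow> ('a \<Rightarrow> 'b::real_normed_vector) \<Rightarrow> bool" where
  "Ck_on 0 S f \<longleftrightarrow> continuous_on S f"
| "Ck_on (Suc k) S f \<longleftrightarrow>
     (\<forall>x\<in>S. f differentiable (at x)) \<and>
     (\<forall>v. Ck_on k S (\<lambda>x. frechet_derivative f (at x) v))"

(* Smoothness on an arbitrary subset: locally the restriction of a C-infinity map defined on an
   open set of the ambient space. *)
definition smooth_on :: "'a::real_normed_vector set \<Rightarrow> ('a \<Rightarrow> 'b::real_normed_vector) \<Rightarrow> bool" where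
  "smooth_on A f \<longleftrightarrow>
     (\<forall>a\<in>A. \<exists>W F. open W \<and> a \<in> W \<and> (\<forall>k. Ck_on k W F) \<and> (\<forall>x\<in>W \<inter> A. F x = f x))"


section \<open>Smooth manifolds\<close>

(* The charts (U, phi) take values in a fixed finite-dimensional linear subspace (the model) of a
   normed space 'e.  Using a subspace instead of the whole type 'e admits every dimension,
   including 0. *)
record ('a, 'e) mfd =
  mtop :: "'a topology"
  model :: "'e set"
  atlas :: "('a set \<times> ('a \<Rightarrow> 'e)) set"

definition smooth_manifold :: "('a, 'e::real_normed_vector) mfd \<Rightarrow> bool" where
  "smooth_manifold M \<longleftrightarrow>
     Hausdorff_space (mtop M) \<and> second_countable (mtop M) \<and>
     (\<exists>B. finite B \<and> model M = span B) \<and>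
     (\<Union>(U, \<phi>)\<in>atlas M. U) = topspace (mtop M) \<and>
     (\<forall>(U, \<phi>)\<in>atlas M.
        openin (mtop M) U \<and> openin (top_of_set (model M)) (\<phi> ` U) \<and>
        homeomorphic_map (subtopology (mtop M) U) (top_of_set (\<phi> ` U)) \<phi>) \<and>
     (\<forall>(U, \<phi>)\<in>atlas M. \<forall>(U', \<phi>')\<in>atlas M.
        smooth_on (\<phi> ` (U \<inter> U')) (\<phi>' \<circ> inv_into U \<phi>))"

definition std_mfd :: "'e::real_normed_vector set \<Rightarrow> ('e, 'e) mfd" where
  "std_mfd W = \<lparr>mtop = top_of_set W, model = UNIV, atlas = {(W, id)}\<rparr>"

definition prod_mfd ::
  "('a, 'e::real_normed_vector) mfd \<Rightarrow> ('b, 'f::real_normed_vector) mfd \<Rightarrow> ('a \<times> 'b, 'e \<times> 'f) mfd"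
where
  "prod_mfd M N =
     \<lparr>mtop = prod_topology (mtop M) (mtop N),
      model = model M \<times> model N,
      atlas = {(U \<times> W, map_prod \<phi> \<psi>) | U \<phi> W \<psi>. (U, \<phi>) \<in> atlas M \<and> (W, \<psi>) \<in> atlas N}\<rparr>"

(* Smoothness of a map defined on a subset S of M, in the sense of local smooth extendability.  If S
   is an embedded submanifold of M, this is smoothness for the submanifold structure of S. *)
definition smooth_map ::
  "('a, 'e::real_normed_vector) mfd \<Rightarrow> ('b, 'f::real_normed_vector) mfd \<Rightarrow> 'a set \<Rightarrow> ('a \<Rightarrow> 'b) \<Rightarrow> bool"
where
  "smooth_map M N S f \<longleftrightarrow>
     S \<subseteq> topspace (mtop M) \<and>
     (\<forall>x\<in>S. \<exists>(U, \<phi>)\<in>atlas M. \<exists>(W, \<psi>)\<in>atlas N. \<exists>D.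
        openin (mtop M) D \<and> x \<in> D \<and> D \<subseteq> U \<and> f ` (S \<inter> D) \<subseteq> W \<and>
        smooth_on (\<phi> ` (S \<inter> D)) (\<psi> \<circ> f \<circ> inv_into U \<phi>))"

definition diffeomorphism ::
  "('a, 'e::real_normed_vector) mfd \<Rightarrow> ('b, 'f::real_normed_vector) mfd \<Rightarrow>
   'a set \<Rightarrow> 'b set \<Rightarrow> ('a \<Rightarrow> 'b) \<Rightarrow> bool"
where
  "diffeomorphism M N S T f \<longleftrightarrow>
     bij_betw f S T \<and> smooth_map M N S f \<and> smooth_map N M T (inv_into S f)"

(* The coordinate expression is defined on a relatively open subset of the model, so its derivative
   is determined exactly on the model; hence inj_on only there. *)
definition immersion ::
  "('a, 'e::real_normed_vector) mfd \<Rightarrow> ('b, 'f::real_normed_vector) mfd \<Rightarrow> ('a \<Rightarrow> 'b) \<Rightarrow> bool"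
where
  "immersion M N f \<longleftrightarrow>
     smooth_map M N (topspace (mtop M)) f \<and>
     (\<forall>(U, \<phi>)\<in>atlas M. \<forall>(W, \<psi>)\<in>atlas N. \<forall>x\<in>U. f x \<in> W \<longrightarrow>
        (\<exists>D. ((\<psi> \<circ> f \<circ> inv_into U \<phi>) has_derivative D) (at (\<phi> x) within \<phi> ` {y \<in> U. f y \<in> W}) \<and>
             inj_on D (model M)))"


section \<open>Lie groups and smooth actions\<close>

definition lie_group :: "('g, 'm) monoid_scheme \<Rightarrow> ('g, 'e::real_normed_vector) mfd \<Rightarrow> bool" where
  "lie_group G M \<longleftrightarrow>
     group G \<and> smooth_manifold M \<and> topspace (mtop M) = carrier G \<and>
     smooth_map (prod_mfd M M) M (carrier G \<times> carrier G) (\<lambda>(x, y). x \<otimes>\<^bsub>G\<^esub> y) \<and>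
     smooth_map M M (carrier G) (\<lambda>x. inv\<^bsub>G\<^esub> x)"

(* The values of the maps alpha g outside X are irrelevant. *)
definition smooth_action ::
  "('g, 'm) monoid_scheme \<Rightarrow> ('g, 'e::real_normed_vector) mfd \<Rightarrow> 'h::euclidean_space set \<Rightarrow>
   ('g \<Rightarrow> 'h \<Rightarrow> 'h) \<Rightarrow> bool"
where
  "smooth_action G M X \<alpha> \<longleftrightarrow>
     (\<forall>g\<in>carrier G. diffeomorphism (std_mfd X) (std_mfd X) X X (\<alpha> g)) \<and>
     (\<forall>g\<^sub>1\<in>carrier G. \<forall>g\<^sub>2\<in>carrier G. \<forall>x\<in>X. \<alpha> (g\<^sub>1 \<otimes>\<^bsub>G\<^esub> g\<^sub>2) x = \<alpha> g\<^sub>1 (\<alpha> g\<^sub>2 x)) \<and>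
     smooth_map (prod_mfd M (std_mfd X)) (std_mfd X) (carrier G \<times> X) (\<lambda>(g, x). \<alpha> g x)"

definition GL :: "('h::euclidean_space \<Rightarrow>\<^sub>L 'h) monoid" where
  "GL = \<lparr>carrier = {A. \<exists>B. A o\<^sub>L B = id_blinfun \<and> B o\<^sub>L A = id_blinfun},
         monoid.mult = (o\<^sub>L), one = id_blinfun\<rparr>"

definition induced_by_affine_rep ::
  "('g, 'm) monoid_scheme \<Rightarrow> 'h::euclidean_space set \<Rightarrow> ('g \<Rightarrow> 'h \<Rightarrow> 'h) \<Rightarrow>
   ('g \<Rightarrow> 'h) \<Rightarrow> ('g \<Rightarrow> 'h \<Rightarrow>\<^sub>L 'h) \<Rightarrow> bool"
where
  "induced_by_affine_rep G X \<alpha> b \<pi> \<longleftrightarrow>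
     (\<forall>g\<in>carrier G. \<pi> g \<in> carrier GL) \<and>
     (\<forall>g\<in>carrier G. \<forall>x\<in>X. \<alpha> g x = b g + \<pi> g x \<and> b g + \<pi> g x \<in> X) \<and>
     (\<forall>g\<^sub>1\<in>carrier G. \<forall>g\<^sub>2\<in>carrier G.
        \<pi> (g\<^sub>1 \<otimes>\<^bsub>G\<^esub> g\<^sub>2) = \<pi> g\<^sub>1 o\<^sub>L \<pi> g\<^sub>2 \<and>
        b (g\<^sub>1 \<otimes>\<^bsub>G\<^esub> g\<^sub>2) = b g\<^sub>1 + \<pi> g\<^sub>1 (b g\<^sub>2))"


section \<open>Lie subgroups of GL(H) and the global Cartan decomposition\<close>

(* A Lie subgroup carries its own Lie group structure M, for which the inclusion is an (injective)
   immersion; it need not be embedded or closed. *)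
definition lie_subgroup_GL ::
  "('h::euclidean_space \<Rightarrow>\<^sub>L 'h) set \<Rightarrow> ('h \<Rightarrow>\<^sub>L 'h, 'e::real_normed_vector) mfd \<Rightarrow> bool"
where
  "lie_subgroup_GL L M \<longleftrightarrow>
     subgroup L GL \<and> lie_group (GL\<lparr>carrier := L\<rparr>) M \<and>
     immersion M (std_mfd (carrier GL)) (\<lambda>A. A)"

definition curve_through_id ::
  "('h::euclidean_space \<Rightarrow>\<^sub>L 'h, 'e::real_normed_vector) mfd \<Rightarrow> (real \<Rightarrow> 'h \<Rightarrow>\<^sub>L 'h) \<Rightarrow> bool"
where
  "curve_through_id M \<gamma> \<longleftrightarrow>
     (\<exists>e>0. smooth_map (std_mfd UNIV) M {-e<..<e} \<gamma>) \<and> \<gamma> 0 = id_blinfun"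

(* The tangent space at the identity, as velocities in End(H) of curves that are smooth for the
   manifold structure of the Lie subgroup. *)
definition lie_algebra ::
  "('h::euclidean_space \<Rightarrow>\<^sub>L 'h, 'e::real_normed_vector) mfd \<Rightarrow> ('h \<Rightarrow>\<^sub>L 'h) set"
where
  "lie_algebra M = {X. \<exists>\<gamma>. curve_through_id M \<gamma> \<and> (\<gamma> has_vector_derivative X) (at 0)}"

(* The differential at the identity sends the velocity of a curve to the velocity of its image;
   this is independent of the curve because the inclusion into GL is an immersion.  It is meant
   for arguments in lie_algebra M. *)
definition differential_at_id ::
  "('h::euclidean_space \<Rightarrow>\<^sub>L 'h, 'e::real_normed_vector) mfd \<Rightarrow>
   (('h \<Rightarrow>\<^sub>L 'h) \<Rightarrow> ('h \<Rightarrow>\<^sub>L 'h)) \<Rightarrow> ('h \<Rightarrow>\<^sub>L 'h) \<Rightarrow> ('h \<Rightarrow>\<^sub>L 'h)"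
where
  "differential_at_id M \<theta> X =
     (THE Y. \<forall>\<gamma>. curve_through_id M \<gamma> \<and> (\<gamma> has_vector_derivative X) (at 0) \<longrightarrow>
        ((\<lambda>t. \<theta> (\<gamma> t)) has_vector_derivative Y) (at 0))"

definition cartan_p ::
  "('h::euclidean_space \<Rightarrow>\<^sub>L 'h, 'e::real_normed_vector) mfd \<Rightarrow>
   (('h \<Rightarrow>\<^sub>L 'h) \<Rightarrow> ('h \<Rightarrow>\<^sub>L 'h)) \<Rightarrow> ('h \<Rightarrow>\<^sub>L 'h) set"
where
  "cartan_p M \<theta> = {X \<in> lie_algebra M. differential_at_id M \<theta> X = - X}"

definition fixed_subgroup ::
  "('h::euclidean_space \<Rightarrow>\<^sub>L 'h) set \<Rightarrow> (('h \<Rightarrow>\<^sub>L 'h) \<Rightarrow> ('h \<Rightarrow>\<^sub>L 'h)) \<Rightarrow> ('h \<Rightarrow>\<^sub>L 'h) set"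
where
  "fixed_subgroup L \<theta> = {l \<in> L. \<theta> l = l}"

definition lie_involution ::
  "('h::euclidean_space \<Rightarrow>\<^sub>L 'h) set \<Rightarrow> ('h \<Rightarrow>\<^sub>L 'h, 'e::real_normed_vector) mfd \<Rightarrow>
   (('h \<Rightarrow>\<^sub>L 'h) \<Rightarrow> ('h \<Rightarrow>\<^sub>L 'h)) \<Rightarrow> bool"
where
  "lie_involution L M \<theta> \<longleftrightarrow>
     \<theta> \<in> iso (GL\<lparr>carrier := L\<rparr>) (GL\<lparr>carrier := L\<rparr>) \<and> smooth_map M M L \<theta> \<and> (\<forall>l\<in>L. \<theta> (\<theta> l) = l)"

definition exp_blinfun :: "('h::euclidean_space \<Rightarrow>\<^sub>L 'h) \<Rightarrow> ('h \<Rightarrow>\<^sub>L 'h)" where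
  "exp_blinfun S = (\<Sum>n. (((o\<^sub>L) S) ^^ n) id_blinfun /\<^sub>R fact n)"

definition global_cartan_decomposition ::
  "('h::euclidean_space \<Rightarrow>\<^sub>L 'h) set \<Rightarrow> ('h \<Rightarrow>\<^sub>L 'h, 'e::real_normed_vector) mfd \<Rightarrow>
   (('h \<Rightarrow>\<^sub>L 'h) \<Rightarrow> ('h \<Rightarrow>\<^sub>L 'h)) \<Rightarrow> bool"
where
  "global_cartan_decomposition L M \<theta> \<longleftrightarrow>
     lie_subgroup_GL L M \<and> lie_involution L M \<theta> \<and>
     diffeomorphism (prod_mfd M (std_mfd UNIV)) M (fixed_subgroup L \<theta> \<times> cartan_p M \<theta>) L
       (\<lambda>(k, S). k o\<^sub>L exp_blinfun S)"

definition self_adjoint :: "('h::euclidean_space \<Rightarrow>\<^sub>L 'h) \<Rightarrow> bool" where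
  "self_adjoint S \<longleftrightarrow> adjoint (blinfun_apply S) = blinfun_apply S"

definition positive_definite :: "('h::euclidean_space \<Rightarrow>\<^sub>L 'h) \<Rightarrow> bool" where
  "positive_definite S \<longleftrightarrow> (\<forall>x. x \<noteq> 0 \<longrightarrow> 0 < x \<bullet> S x)"


section \<open>Optimal transport\<close>

abbreviation borel_of :: "'h::euclidean_space set \<Rightarrow> 'h measure" where
  "borel_of X \<equiv> restrict_space borel X"

definition borel_prob_measures :: "'h::euclidean_space set \<Rightarrow> 'h measure set" where
  "borel_prob_measures X = {\<mu>. prob_space \<mu> \<and> sets \<mu> = sets (borel_of X)}"

definition stabilizer ::
  "('g, 'm) monoid_scheme \<Rightarrow> 'h::euclidean_space set \<Rightarrow> ('g \<Rightarrow> 'h \<Rightarrow> 'h) \<Rightarrow> 'h measure \<Rightarrow> 'g set"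
where
  "stabilizer G X \<alpha> \<rho> = {h \<in> carrier G. distr \<rho> (borel_of X) (\<alpha> h) = \<rho>}"

definition sq_dist_cost :: "'h::euclidean_space \<Rightarrow> 'h \<Rightarrow> real" where
  "sq_dist_cost x y = (norm (x - y))\<^sup>2"

(* All costs are nonnegative; the values of the transport problems lie in [0, infinity]. *)

definition transport_maps ::
  "'h::euclidean_space set \<Rightarrow> 'h measure \<Rightarrow> 'h measure \<Rightarrow> ('h \<Rightarrow> 'h) set"
where
  "transport_maps X \<mu>\<^sub>0 \<mu>\<^sub>1 =
     {T \<in> borel_of X \<rightarrow>\<^sub>M borel_of X. distr \<mu>\<^sub>0 (borel_of X) T = \<mu>\<^sub>1}"

definition monge_cost :: "('h::euclidean_space \<Rightarrow> 'h \<Rightarrow> real) \<Rightarrow> 'h measure \<Rightarrow> ('h \<Rightarrow> 'h) \<Rightarrow> ennreal" where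
  "monge_cost c \<mu>\<^sub>0 T = (\<integral>\<^sup>+x. ennreal (c x (T x)) \<partial>\<mu>\<^sub>0)"

definition monge ::
  "'h::euclidean_space set \<Rightarrow> ('h \<Rightarrow> 'h \<Rightarrow> real) \<Rightarrow> 'h measure \<Rightarrow> 'h measure \<Rightarrow> ennreal"
where
  "monge X c \<mu>\<^sub>0 \<mu>\<^sub>1 = (INF T\<in>transport_maps X \<mu>\<^sub>0 \<mu>\<^sub>1. monge_cost c \<mu>\<^sub>0 T)"

definition solves_monge ::
  "'h::euclidean_space set \<Rightarrow> ('h \<Rightarrow> 'h \<Rightarrow> real) \<Rightarrow> 'h measure \<Rightarrow> 'h measure \<Rightarrow> ('h \<Rightarrow> 'h) \<Rightarrow> bool"
where
  "solves_monge X c \<mu>\<^sub>0 \<mu>\<^sub>1 T \<longleftrightarrow>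
     T \<in> transport_maps X \<mu>\<^sub>0 \<mu>\<^sub>1 \<and> monge_cost c \<mu>\<^sub>0 T = monge X c \<mu>\<^sub>0 \<mu>\<^sub>1"

definition couplings ::
  "'h::euclidean_space set \<Rightarrow> 'h measure \<Rightarrow> 'h measure \<Rightarrow> ('h \<times> 'h) measure set"
where
  "couplings X \<mu>\<^sub>0 \<mu>\<^sub>1 =
     {\<Gamma>. prob_space \<Gamma> \<and> sets \<Gamma> = sets (borel_of X \<Otimes>\<^sub>M borel_of X) \<and>
         distr \<Gamma> (borel_of X) fst = \<mu>\<^sub>0 \<and> distr \<Gamma> (borel_of X) snd = \<mu>\<^sub>1}"

definition kantorovich_cost ::
  "('h::euclidean_space \<Rightarrow> 'h \<Rightarrow> real) \<Rightarrow> ('h \<times> 'h) measure \<Rightarrow> ennreal"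
where
  "kantorovich_cost c \<Gamma> = (\<integral>\<^sup>+(x, y). ennreal (c x y) \<partial>\<Gamma>)"

definition kantorovich ::
  "'h::euclidean_space set \<Rightarrow> ('h \<Rightarrow> 'h \<Rightarrow> real) \<Rightarrow> 'h measure \<Rightarrow> 'h measure \<Rightarrow> ennreal"
where
  "kantorovich X c \<mu>\<^sub>0 \<mu>\<^sub>1 = (INF \<Gamma>\<in>couplings X \<mu>\<^sub>0 \<mu>\<^sub>1. kantorovich_cost c \<Gamma>)"

definition solves_kantorovich ::
  "'h::euclidean_space set \<Rightarrow> ('h \<Rightarrow> 'h \<Rightarrow> real) \<Rightarrow> 'h measure \<Rightarrow> 'h measure \<Rightarrow> ('h \<times> 'h) measure \<Rightarrow> bool"
where
  "solves_kantorovich X c \<mu>\<^sub>0 \<mu>\<^sub>1 \<Gamma> \<longleftrightarrow>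
     \<Gamma> \<in> couplings X \<mu>\<^sub>0 \<mu>\<^sub>1 \<and> kantorovich_cost c \<Gamma> = kantorovich X c \<mu>\<^sub>0 \<mu>\<^sub>1"

definition orbit_cost ::
  "('g, 'm) monoid_scheme \<Rightarrow> ('g \<Rightarrow> 'h::euclidean_space \<Rightarrow> 'h) \<Rightarrow> 'h measure \<Rightarrow>
   ('h \<Rightarrow> 'h \<Rightarrow> real) \<Rightarrow> 'g \<Rightarrow> 'g \<Rightarrow> 'g \<Rightarrow> ennreal"
where
  "orbit_cost G \<alpha> \<rho> c g\<^sub>0 g\<^sub>1 h = (\<integral>\<^sup>+x. ennreal (c (\<alpha> g\<^sub>0 x) (\<alpha> (g\<^sub>1 \<otimes>\<^bsub>G\<^esub> h) x)) \<partial>\<rho>)"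

definition orbit_transport ::
  "('g, 'm) monoid_scheme \<Rightarrow> 'h::euclidean_space set \<Rightarrow> ('g \<Rightarrow> 'h \<Rightarrow> 'h) \<Rightarrow> 'h measure \<Rightarrow>
   ('h \<Rightarrow> 'h \<Rightarrow> real) \<Rightarrow> 'g \<Rightarrow> 'g \<Rightarrow> ennreal"
where
  "orbit_transport G X \<alpha> \<rho> c g\<^sub>0 g\<^sub>1 = (INF h\<in>stabilizer G X \<alpha> \<rho>. orbit_cost G \<alpha> \<rho> c g\<^sub>0 g\<^sub>1 h)"

end

theory Submission
  imports Defs
begin

text \<open>
An affine map T x = v + A x with A self-adjoint and positive definite is the gradient of the
strictly convex quadratic (A x \<bullet> x) / 2 + v \<bullet> x, and its inverse is the gradient of the
convex conjugate. By Young's inequality with these two functions, T is optimal for the quadratic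
cost. Here the inequality has an explicit defect: with B the inverse of A,
the cost of a pair (x, y) is a function of x plus a function of y plus (y - T x) \<bullet> B (y - T x).
Integrating against a coupling, the first two terms depend on the marginals only, and the last one is
nonnegative and vanishes exactly when the coupling is concentrated on the graph of T. This yields
optimality and uniqueness of the plan (\<open>affine_plan_optimal\<close>). Every transport map and every
element of the stabilizer induces a coupling of the same cost (\<open>distr_pair_coupling\<close>), so
the Monge and the orbit problem are bounded below by the Kantorovich problem; if T is of the form
\<open>\<alpha> (g\<^sub>1 h g\<^sub>0\<inverse>)\<close> with h in the stabilizer, it attains all three infima.

It remains to choose h such that the linear part \<open>\<pi> g\<^sub>1 \<circ> \<pi> h \<circ> (\<pi> g\<^sub>0)\<inverse>\<close> is self-adjoint and
positive definite. Decompose the inverses of \<open>\<pi> g\<^sub>0\<close> and \<open>\<pi> g\<^sub>1\<close> as \<open>k\<^sub>i e\<^sub>i\<close>, with \<open>k\<^sub>i\<close> fixed by the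
involution and \<open>e\<^sub>i\<close> an exponential, and decompose once more \<open>e\<^sub>1 e\<^sub>0 = k e\<close>. For the fixed
element \<open>k\<^sub>1 k k\<^sub>0\<inverse>\<close> in the middle, the product collapses to \<open>e\<^sub>0 e\<inverse> e\<^sub>0\<close>
(\<open>cartan_alignment\<close>), which is congruent to the inverse of an exponential of a self-adjoint
operator. Every element fixed by the involution is the linear part of an element of the stabilizer, and for
\<open>k\<^sub>1 k k\<^sub>0\<inverse>\<close> this element is the required h.
\<close>

section \<open>Positive definite operators\<close>

lemma self_adjoint_inner: "self_adjoint A \<longleftrightarrow> (\<forall>x y. A x \<bullet> y = x \<bullet> A y)"
  unfolding self_adjoint_def
  by (metis adjoint_unique adjoint_works blinfun.bounded_linear_right bounded_linear.linear)

lemma inverse_self_adjoint_positive_definite: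
  fixes A B :: "'h::euclidean_space \<Rightarrow>\<^sub>L 'h"
  assumes A: "self_adjoint A" "positive_definite A" and AB: "A o\<^sub>L B = id_blinfun"
  shows "self_adjoint B" "positive_definite B"
proof -
  have AB': "A (B x) = x" for x
    using AB by (metis blinfun_apply_blinfun_compose id_blinfun.rep_eq id_apply)
  show "self_adjoint B"
    using A(1) AB' unfolding self_adjoint_inner by metis
  show "positive_definite B"
    unfolding positive_definite_def
  proof (intro allI impI)
    fix x :: 'h assume "x \<noteq> 0"
    then have "B x \<noteq> 0" using AB'[of x] by auto
    then have "0 < B x \<bullet> A (B x)" using A(2) unfolding positive_definite_def by blast
    then show "0 < x \<bullet> B x" by (simp add: AB' inner_commute)
  qed
qed

lemma congruence_self_adjoint_positive_definite:
  fixes A E :: "'h::euclidean_space \<Rightarrow>\<^sub>L 'h"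
  assumes A: "self_adjoint A" "positive_definite A"
    and E: "self_adjoint E" "\<And>x. E x = 0 \<Longrightarrow> x = 0"
  shows "self_adjoint (E o\<^sub>L A o\<^sub>L E)" "positive_definite (E o\<^sub>L A o\<^sub>L E)"
proof -
  show "self_adjoint (E o\<^sub>L A o\<^sub>L E)"
    using A(1) E(1) by (simp add: self_adjoint_inner)
  have "0 < x \<bullet> E (A (E x))" if "x \<noteq> 0" for x
  proof -
    have "E x \<noteq> 0" using E(2) that by blast
    then have "0 < E x \<bullet> A (E x)" using A(2) unfolding positive_definite_def by blast
    then show ?thesis using E(1) unfolding self_adjoint_inner by metis
  qed
  then show "positive_definite (E o\<^sub>L A o\<^sub>L E)"
    by (simp add: positive_definite_def)
qed

lemma summable_exp_blinfun:
  "summable (\<lambda>n. (((o\<^sub>L) S) ^^ n) id_blinfun /\<^sub>R fact n :: 'h::euclidean_space \<Rightarrow>\<^sub>L 'h)"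
proof (rule summable_comparison_test')
  have "norm ((((o\<^sub>L) S) ^^ n) id_blinfun) \<le> norm S ^ n" for n
  proof (induction n)
    case 0
    then show ?case by (simp add: norm_blinfun_id_le)
  next
    case (Suc n)
    have "norm (S o\<^sub>L (((o\<^sub>L) S) ^^ n) id_blinfun) \<le> norm S * norm ((((o\<^sub>L) S) ^^ n) id_blinfun)"
      by (rule norm_blinfun_compose)
    also have "\<dots> \<le> norm S * norm S ^ n"
      by (intro mult_left_mono Suc.IH) simp
    finally show ?case by simp
  qed
  then show "norm ((((o\<^sub>L) S) ^^ n) id_blinfun /\<^sub>R fact n) \<le> norm S ^ n /\<^sub>R fact n" for n
    by (simp add: divide_simps)
  show "summable (\<lambda>n. norm S ^ n /\<^sub>R fact n)"
    by (rule summable_exp_generic)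
qed

text \<open>Properties of the exponential are derived from its matrix coefficients, which are real power series in
the powers of S.\<close>
lemma exp_blinfun_inner_sums:
  "(\<lambda>n. x \<bullet> (blinfun_apply S ^^ n) y / fact n) sums (x \<bullet> exp_blinfun S y)"
proof -
  have pow: "blinfun_apply ((((o\<^sub>L) S) ^^ n) id_blinfun) = blinfun_apply S ^^ n" for n
    by (induction n) (auto simp: fun_eq_iff)
  have "(\<lambda>n. (((o\<^sub>L) S) ^^ n) id_blinfun /\<^sub>R fact n) sums exp_blinfun S"
    unfolding exp_blinfun_def by (rule summable_sums[OF summable_exp_blinfun])
  moreover have "bounded_linear (\<lambda>Z. x \<bullet> blinfun_apply Z y)"
    by (intro bounded_linear_inner_right_comp blinfun.bounded_linear_left)
  ultimately have "(\<lambda>n. x \<bullet> ((((o\<^sub>L) S) ^^ n) id_blinfun /\<^sub>R fact n) y) sums (x \<bullet> exp_blinfun S y)"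
    using bounded_linear.sums by blast
  then show ?thesis
    by (simp add: blinfun.scaleR_left pow divide_inverse mult.commute)
qed

lemma self_adjoint_funpow_inner:
  assumes "self_adjoint S"
  shows "(blinfun_apply S ^^ i) x \<bullet> (blinfun_apply S ^^ j) y = x \<bullet> (blinfun_apply S ^^ (i + j)) y"
proof (induction i arbitrary: j)
  case (Suc i)
  have "(blinfun_apply S ^^ Suc i) x \<bullet> (blinfun_apply S ^^ j) y
      = (blinfun_apply S ^^ i) x \<bullet> (blinfun_apply S ^^ Suc j) y"
    using assms by (simp add: self_adjoint_inner)
  also have "\<dots> = x \<bullet> (blinfun_apply S ^^ (i + Suc j)) y"
    by (rule Suc.IH)
  finally show ?case by simp
qed simp

lemma exp_blinfun_self_adjoint:
  assumes "self_adjoint S"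
  shows "self_adjoint (exp_blinfun S)"
  unfolding self_adjoint_inner
proof (intro allI)
  fix x y
  have "x \<bullet> (blinfun_apply S ^^ n) y = y \<bullet> (blinfun_apply S ^^ n) x" for n
    using self_adjoint_funpow_inner[OF assms, of n x 0 y] by (simp add: inner_commute)
  then have "x \<bullet> exp_blinfun S y = y \<bullet> exp_blinfun S x"
    using exp_blinfun_inner_sums[of x S y] exp_blinfun_inner_sums[of y S x]
    by (simp add: sums_iff)
  then show "exp_blinfun S x \<bullet> y = x \<bullet> exp_blinfun S y"
    by (simp add: inner_commute)
qed

text \<open>The value is the squared norm of exp(S/2) x. Expanding that norm in an orthonormal basis reduces the
identity exp(S/2) exp(S/2) = exp S to Cauchy products of real series: by self-adjointness the n-th
term of the product is x \<bullet> S^n x / n! times 2^(-n) times the sum of the n-th row of Pascal's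
triangle.\<close>
lemma exp_blinfun_nonneg:
  fixes S :: "'h::euclidean_space \<Rightarrow>\<^sub>L 'h"
  assumes "self_adjoint S"
  shows "0 \<le> x \<bullet> exp_blinfun S x"
proof -
  define p where "p n = (blinfun_apply S ^^ n) x" for n
  \<comment> \<open>the n-th term of the series for the coordinate of exp(S/2) x along e\<close>
  define u where "u e n = (1/2) ^ n * (e \<bullet> p n) / fact n" for e n
  have norm_p: "norm (p n) \<le> norm S ^ n * norm x" for n
  proof (induction n)
    case (Suc n)
    have "norm (p (Suc n)) \<le> norm S * norm (p n)"
      by (simp add: p_def norm_blinfun)
    also have "\<dots> \<le> norm S * (norm S ^ n * norm x)"
      by (intro mult_left_mono Suc.IH) simp
    finally show ?case by (simp add: ac_simps)
  qed (simp add: p_def)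
  have u_abs: "summable (\<lambda>n. norm (u e n))" if "e \<in> Basis" for e
  proof (rule summable_comparison_test')
    show "summable (\<lambda>n. (norm S ^ n /\<^sub>R fact n) * norm x)"
      by (intro summable_mult2 summable_exp_generic)
    fix n
    have "\<bar>e \<bullet> p n\<bar> \<le> norm S ^ n * norm x"
      using Basis_le_norm[OF that, of "p n"] norm_p[of n] by (simp add: inner_commute)
    moreover have "(1/2::real) ^ n \<le> 1" by (simp add: power_le_one)
    ultimately have "(1/2) ^ n * \<bar>e \<bullet> p n\<bar> \<le> 1 * (norm S ^ n * norm x)"
      by (intro mult_mono) auto
    then show "norm (norm (u e n)) \<le> (norm S ^ n /\<^sub>R fact n) * norm x"
      by (simp add: u_def abs_mult divide_simps)
  qed
  have "(\<lambda>n. \<Sum>e\<in>Basis. \<Sum>i\<le>n. u e i * u e (n - i)) sums (\<Sum>e\<in>Basis. (\<Sum>n. u e n) * (\<Sum>n. u e n))"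
    by (intro sums_sum Cauchy_product_sums u_abs)
  moreover have "(\<Sum>e\<in>Basis. \<Sum>i\<le>n. u e i * u e (n - i)) = x \<bullet> p n / fact n" for n
  proof -
    have "(\<Sum>e\<in>Basis. \<Sum>i\<le>n. u e i * u e (n - i))
        = (\<Sum>i\<le>n. \<Sum>e\<in>Basis. u e i * u e (n - i))"
      by (rule sum.swap)
    also have "\<dots> = (\<Sum>i\<le>n. (1/2) ^ n * (x \<bullet> p n) / fact n * of_nat (n choose i))"
    proof (rule sum.cong[OF refl])
      fix i assume "i \<in> {..n}"
      then have i: "i \<le> n" by simp
      have "(\<Sum>e\<in>Basis. u e i * u e (n - i))
          = (1/2) ^ i * (1/2) ^ (n - i) / (fact i * fact (n - i)) * (\<Sum>e\<in>Basis. (p i \<bullet> e) * (p (n - i) \<bullet> e))"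
        unfolding sum_distrib_left
        by (rule sum.cong[OF refl]) (simp add: u_def inner_commute)
      also have "(\<Sum>e\<in>Basis. (p i \<bullet> e) * (p (n - i) \<bullet> e)) = p i \<bullet> p (n - i)"
        by (rule euclidean_inner[symmetric])
      also have "\<dots> = x \<bullet> p n"
        using self_adjoint_funpow_inner[OF assms, of i x "n - i" x] i by (simp add: p_def)
      also have "(1/2::real) ^ i * (1/2) ^ (n - i) = (1/2) ^ n"
        using i by (simp flip: power_add)
      finally show "(\<Sum>e\<in>Basis. u e i * u e (n - i)) = (1/2) ^ n * (x \<bullet> p n) / fact n * of_nat (n choose i)"
        using i by (simp add: binomial_fact)
    qed
    also have "\<dots> = (1/2) ^ n * (x \<bullet> p n) / fact n * of_nat (\<Sum>i\<le>n. n choose i)"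
      by (simp add: sum_distrib_left)
    also have "\<dots> = x \<bullet> p n / fact n"
      unfolding choose_row_sum by (simp add: power_one_over)
    finally show ?thesis .
  qed
  ultimately have "(\<lambda>n. x \<bullet> p n / fact n) sums (\<Sum>e\<in>Basis. (\<Sum>n. u e n) * (\<Sum>n. u e n))"
    by simp
  then have "x \<bullet> exp_blinfun S x = (\<Sum>e\<in>Basis. (\<Sum>n. u e n) * (\<Sum>n. u e n))"
    using exp_blinfun_inner_sums[of x S x] unfolding p_def by (rule sums_unique2[rotated])
  then show ?thesis by (simp add: sum_nonneg)
qed

text \<open>If x \<bullet> A x = 0, then x minimizes the nonnegative quadratic form of A, so its gradient 2 A x vanishes
there.\<close>
lemma nonneg_injective_positive_definite:
  fixes A :: "'h::euclidean_space \<Rightarrow>\<^sub>L 'h"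
  assumes A: "self_adjoint A" and nonneg: "\<And>x. 0 \<le> x \<bullet> A x" and inj: "\<And>x. A x = 0 \<Longrightarrow> x = 0"
  shows "positive_definite A"
  unfolding positive_definite_def
proof (intro allI impI)
  fix x :: 'h assume "x \<noteq> 0"
  define y where "y = A x"
  have "y \<noteq> 0" using inj[of x] \<open>x \<noteq> 0\<close> by (auto simp: y_def)
  have sym: "x \<bullet> A y = y \<bullet> y"
    using A unfolding self_adjoint_inner y_def by metis
  show "0 < x \<bullet> A x"
  proof (rule ccontr)
    assume "\<not> 0 < x \<bullet> A x"
    then have zero: "x \<bullet> y = 0" using nonneg[of x] by (simp add: y_def)
    \<comment> \<open>the form at x - t (A x); its linear term in t would make it negative for small t > 0\<close>
    have quad: "0 \<le> t\<^sup>2 * (y \<bullet> A y) - 2 * t * (y \<bullet> y)" for t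
      using nonneg[of "x - t *\<^sub>R y"] zero sym
      by (simp add: blinfun.diff_right blinfun.scaleR_right inner_diff inner_commute y_def[symmetric]
          power2_eq_square algebra_simps)
    define c where "c = y \<bullet> A y"
    define d where "d = y \<bullet> y"
    have "0 < d" using \<open>y \<noteq> 0\<close> d_def by simp
    have "0 \<le> c" using nonneg c_def by blast
    define t where "t = d / (c + 1)"
    have "0 < t" using \<open>0 < d\<close> \<open>0 \<le> c\<close> by (simp add: t_def)
    have "t * c \<le> d" using \<open>0 < d\<close> \<open>0 \<le> c\<close> by (simp add: t_def field_simps)
    then have "t * (t * c) < t * (2 * d)" using \<open>0 < t\<close> \<open>0 < d\<close> by simp
    then show False
      using quad[of t] by (simp add: c_def[symmetric] d_def[symmetric] power2_eq_square algebra_simps)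
  qed
qed

section \<open>The alignment of two elements of a Cartan-decomposed group\<close>

lemma GL_simps [simp]:
  "A \<otimes>\<^bsub>GL\<^esub> B = A o\<^sub>L B" "\<one>\<^bsub>GL\<^esub> = id_blinfun"
  by (simp_all add: GL_def)

lemma blinfun_compose_id [simp]: "id_blinfun o\<^sub>L A = A" "A o\<^sub>L id_blinfun = A"
  by (auto intro!: blinfun_eqI)

lemma blinfun_compose_assoc_right: "(A o\<^sub>L B) o\<^sub>L C = A o\<^sub>L (B o\<^sub>L C)"
  by (auto intro!: blinfun_eqI)

lemma group_GL: "group (GL :: ('h::euclidean_space \<Rightarrow>\<^sub>L 'h) monoid)"
proof (rule groupI)
  fix A B :: "'h \<Rightarrow>\<^sub>L 'h" assume "A \<in> carrier GL" "B \<in> carrier GL"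
  then obtain A' B' where *: "A o\<^sub>L A' = id_blinfun" "A' o\<^sub>L A = id_blinfun"
      "B o\<^sub>L B' = id_blinfun" "B' o\<^sub>L B = id_blinfun"
    by (auto simp: GL_def)
  have "(A o\<^sub>L B) o\<^sub>L (B' o\<^sub>L A') = A o\<^sub>L (B o\<^sub>L B') o\<^sub>L A'"
       "(B' o\<^sub>L A') o\<^sub>L (A o\<^sub>L B) = B' o\<^sub>L (A' o\<^sub>L A) o\<^sub>L B"
    by (simp_all add: blinfun_compose_assoc_right)
  with * show "A \<otimes>\<^bsub>GL\<^esub> B \<in> carrier GL"
    by (auto simp: GL_def intro!: exI[of _ "B' o\<^sub>L A'"])
next
  show "\<one>\<^bsub>GL\<^esub> \<in> carrier GL" by (auto simp: GL_def intro!: exI[of _ id_blinfun])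
next
  fix A :: "'h \<Rightarrow>\<^sub>L 'h" assume "A \<in> carrier GL"
  then show "\<exists>B\<in>carrier GL. B \<otimes>\<^bsub>GL\<^esub> A = \<one>\<^bsub>GL\<^esub>" by (auto simp: GL_def)
qed (simp_all add: blinfun_compose_assoc_right)

text \<open>
The set P plays the role of the exponentials, which need not form a subgroup. Decomposing the inverses
of the two elements puts the factors from K next to the middle factor, where they can be cancelled;
what is left on the outside is \<open>inv e\<^sub>1\<close> on the left and \<open>e\<^sub>0\<close> on the right, and decomposing
\<open>e\<^sub>1 \<otimes> e\<^sub>0\<close> makes the product symmetric.\<close>
lemma (in group) cartan_alignment:
  assumes L: "subgroup L G" and K: "subgroup K G"
    and P: "P \<subseteq> L" and decomp: "\<And>l. l \<in> L \<Longrightarrow> \<exists>k\<in>K. \<exists>e\<in>P. l = k \<otimes> e"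
    and l: "l\<^sub>0 \<in> L" "l\<^sub>1 \<in> L"
  shows "\<exists>k\<in>K. \<exists>e\<^sub>0\<in>P. \<exists>e\<in>P. l\<^sub>1 \<otimes> k \<otimes> inv l\<^sub>0 = e\<^sub>0 \<otimes> inv e \<otimes> e\<^sub>0"
proof -
  interpret L: subgroup L G by fact
  interpret K: subgroup K G by fact
  obtain k\<^sub>0 e\<^sub>0 where 0: "k\<^sub>0 \<in> K" "e\<^sub>0 \<in> P" "inv l\<^sub>0 = k\<^sub>0 \<otimes> e\<^sub>0"
    using decomp l(1) by blast
  obtain k\<^sub>1 e\<^sub>1 where 1: "k\<^sub>1 \<in> K" "e\<^sub>1 \<in> P" "inv l\<^sub>1 = k\<^sub>1 \<otimes> e\<^sub>1"
    using decomp l(2) by blast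
  have "e\<^sub>1 \<otimes> e\<^sub>0 \<in> L" using 0 1 P by blast
  then obtain k e where 2: "k \<in> K" "e \<in> P" "e\<^sub>1 \<otimes> e\<^sub>0 = k \<otimes> e"
    using decomp by blast
  have carr: "l\<^sub>0 \<in> carrier G" "l\<^sub>1 \<in> carrier G" "k\<^sub>0 \<in> carrier G" "k\<^sub>1 \<in> carrier G" "k \<in> carrier G"
      "e\<^sub>0 \<in> carrier G" "e\<^sub>1 \<in> carrier G" "e \<in> carrier G"
    using 0 1 2 l P by auto
  have l1: "l\<^sub>1 = inv e\<^sub>1 \<otimes> inv k\<^sub>1"
    using 1(3) carr by (metis inv_inv inv_mult_group)
  have k: "k = e\<^sub>1 \<otimes> e\<^sub>0 \<otimes> inv e"
    using 2(3) carr by (metis inv_solve_right m_closed)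
  have cancel: "inv a \<otimes> (a \<otimes> c) = c" if "a \<in> carrier G" "c \<in> carrier G" for a c
    using that by (metis m_assoc inv_closed l_inv l_one)
  have "l\<^sub>1 \<otimes> (k\<^sub>1 \<otimes> k \<otimes> inv k\<^sub>0) \<otimes> inv l\<^sub>0 = inv e\<^sub>1 \<otimes> (k \<otimes> e\<^sub>0)"
    using carr(3-8) by (simp add: 0(3) l1 m_assoc cancel)
  also have "\<dots> = e\<^sub>0 \<otimes> inv e \<otimes> e\<^sub>0"
    using carr(6-8) by (simp add: k m_assoc cancel)
  finally show ?thesis
    using 0(1,2) 1(1) 2(1,2) by (meson K.m_closed K.m_inv_closed)
qed

lemma subgroup_fixed_subgroup:
  assumes L: "subgroup L GL" and \<theta>: "\<theta> \<in> hom (GL\<lparr>carrier := L\<rparr>) (GL\<lparr>carrier := L\<rparr>)"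
  shows "subgroup (fixed_subgroup L \<theta>) GL"
proof -
  interpret GL: group GL by (rule group_GL)
  interpret L: subgroup L GL by fact
  have gL: "group (GL\<lparr>carrier := L\<rparr>)" by (rule L.subgroup_is_group[OF group_GL])
  interpret \<theta>: group_hom "GL\<lparr>carrier := L\<rparr>" "GL\<lparr>carrier := L\<rparr>" \<theta>
    using gL \<theta> by (simp add: group_hom_def group_hom_axioms_def)
  show ?thesis
  proof (rule GL.subgroupI)
    show "fixed_subgroup L \<theta> \<subseteq> carrier GL"
      using L.subset by (auto simp: fixed_subgroup_def)
    show "fixed_subgroup L \<theta> \<noteq> {}"
      using L.one_closed \<theta>.hom_one by (auto simp: fixed_subgroup_def)
  next
    fix a assume a: "a \<in> fixed_subgroup L \<theta>"
    then have "\<theta> (inv\<^bsub>GL\<lparr>carrier := L\<rparr>\<^esub> a) = inv\<^bsub>GL\<lparr>carrier := L\<rparr>\<^esub> a"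
      using \<theta>.hom_inv[of a] by (simp add: fixed_subgroup_def)
    then show "inv\<^bsub>GL\<^esub> a \<in> fixed_subgroup L \<theta>"
      using a GL.m_inv_consistent[OF L, of a] by (auto simp: fixed_subgroup_def)
  next
    fix a b assume "a \<in> fixed_subgroup L \<theta>" "b \<in> fixed_subgroup L \<theta>"
    then show "a \<otimes>\<^bsub>GL\<^esub> b \<in> fixed_subgroup L \<theta>"
      using \<theta>.hom_mult[of a b] L.m_closed[of a b] by (auto simp: fixed_subgroup_def)
  qed
qed

text \<open>
Taking the identity as fixed factor in the decomposition shows that the exponentials of elements of
the -1 eigenspace belong to L. Hence they are invertible, which turns their positive semidefiniteness
into definiteness. The aligned product is a congruence transform of the inverse of such an
exponential.\<close>
lemma cartan_positive_definite_alignment: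
  fixes L :: "('h::euclidean_space \<Rightarrow>\<^sub>L 'h) set"
  assumes cartan: "global_cartan_decomposition L M \<theta>"
    and sa: "\<forall>S\<in>cartan_p M \<theta>. self_adjoint S"
    and l: "l\<^sub>0 \<in> L" "l\<^sub>1 \<in> L"
  obtains k where "k \<in> fixed_subgroup L \<theta>"
    "self_adjoint (l\<^sub>1 o\<^sub>L k o\<^sub>L inv\<^bsub>GL\<^esub> l\<^sub>0)" "positive_definite (l\<^sub>1 o\<^sub>L k o\<^sub>L inv\<^bsub>GL\<^esub> l\<^sub>0)"
proof -
  interpret GL: group GL by (rule group_GL)
  define K where "K = fixed_subgroup L \<theta>"
  define P where "P = exp_blinfun ` cartan_p M \<theta>"
  have L: "subgroup L GL" and hom: "\<theta> \<in> hom (GL\<lparr>carrier := L\<rparr>) (GL\<lparr>carrier := L\<rparr>)"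
    and bij: "bij_betw (\<lambda>(k, S). k o\<^sub>L exp_blinfun S) (K \<times> cartan_p M \<theta>) L"
    using cartan unfolding global_cartan_decomposition_def lie_subgroup_GL_def lie_involution_def
      diffeomorphism_def iso_def K_def by auto
  have K: "subgroup K GL"
    unfolding K_def by (rule subgroup_fixed_subgroup[OF L hom])
  have decomp: "\<exists>k\<in>K. \<exists>e\<in>P. l = k \<otimes>\<^bsub>GL\<^esub> e" if "l \<in> L" for l
    using that bij_betw_imp_surj_on[OF bij] unfolding P_def by force
  have P: "P \<subseteq> L"
  proof
    fix e assume "e \<in> P"
    then obtain S where S: "S \<in> cartan_p M \<theta>" "e = exp_blinfun S" by (auto simp: P_def)
    have "id_blinfun \<in> K" using subgroup.one_closed[OF K] by simp
    with S have "id_blinfun o\<^sub>L e \<in> L" using bij_betwE[OF bij] by fastforce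
    then show "e \<in> L" by simp
  qed
  have invG: "e o\<^sub>L inv\<^bsub>GL\<^esub> e = id_blinfun" "inv\<^bsub>GL\<^esub> e o\<^sub>L e = id_blinfun" if "e \<in> P" for e
    using that P L GL.r_inv[of e] GL.l_inv[of e] subgroup.subset by fastforce+
  have inj: "x = 0" if "e \<in> P" "blinfun_apply e x = 0" for e x
    using arg_cong[OF invG(2)[OF that(1)], of "\<lambda>A. blinfun_apply A x"] that(2)
    by (simp add: blinfun.zero_right)
  have spd: "self_adjoint e" "positive_definite e" if "e \<in> P" for e
  proof -
    obtain S where S: "self_adjoint S" "e = exp_blinfun S" using \<open>e \<in> P\<close> sa by (auto simp: P_def)
    show "self_adjoint e" using S exp_blinfun_self_adjoint by blast
    then show "positive_definite e"
      using inj[OF \<open>e \<in> P\<close>] S exp_blinfun_nonneg by (auto intro: nonneg_injective_positive_definite)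
  qed
  have "\<exists>k\<in>K. \<exists>e\<^sub>0\<in>P. \<exists>e\<in>P. l\<^sub>1 \<otimes>\<^bsub>GL\<^esub> k \<otimes>\<^bsub>GL\<^esub> inv\<^bsub>GL\<^esub> l\<^sub>0 = e\<^sub>0 \<otimes>\<^bsub>GL\<^esub> inv\<^bsub>GL\<^esub> e \<otimes>\<^bsub>GL\<^esub> e\<^sub>0"
    by (rule GL.cartan_alignment[OF L K P _ l]) (rule decomp)
  then obtain k e\<^sub>0 e where *: "k \<in> K" "e\<^sub>0 \<in> P" "e \<in> P"
      "l\<^sub>1 o\<^sub>L k o\<^sub>L inv\<^bsub>GL\<^esub> l\<^sub>0 = e\<^sub>0 o\<^sub>L inv\<^bsub>GL\<^esub> e o\<^sub>L e\<^sub>0"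
    unfolding GL_simps by blast
  note inv_e = inverse_self_adjoint_positive_definite[OF spd[OF *(3)] invG(1)[OF *(3)]]
  show ?thesis
    using that[of k] * congruence_self_adjoint_positive_definite[OF inv_e spd(1)[OF *(2)] inj[OF *(2)]]
    by (simp add: K_def)
qed

section \<open>Optimality of affine maps with positive definite linear part\<close>

text \<open>These functions make up the terms of the cost that depend on one marginal only, so a finite second
moment gives real-valued integrals for them; it also passes to images under affine maps.\<close>
lemma integrable_inner_affine:
  fixes M :: "'h::euclidean_space measure" and P Q :: "'h \<Rightarrow>\<^sub>L 'h"
  assumes "finite_measure M" and sets: "sets M = sets (borel_of X)"
    and sq: "integrable M (\<lambda>x. (norm x)\<^sup>2)"
  shows "integrable M (\<lambda>x. (u + P x) \<bullet> (w + Q x))"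
proof -
  interpret finite_measure M by fact
  have bound: "(norm (u + P x))\<^sup>2 \<le> 2 * (norm u)\<^sup>2 + 2 * (norm P)\<^sup>2 * (norm x)\<^sup>2"
    for u and P :: "'h \<Rightarrow>\<^sub>L 'h" and x
  proof -
    have "norm (u + P x) \<le> norm u + norm P * norm x"
      using norm_triangle_ineq[of u "P x"] norm_blinfun[of P x] by linarith
    then have "(norm (u + P x))\<^sup>2 \<le> (norm u + norm P * norm x)\<^sup>2"
      by (intro power_mono) auto
    also have "\<dots> \<le> 2 * (norm u)\<^sup>2 + 2 * (norm P * norm x)\<^sup>2"
      using sum_squares_bound[of "norm u" "norm P * norm x"] by (simp add: power2_sum)
    finally show ?thesis by (simp add: power_mult_distrib)
  qed
  have "integrable M (\<lambda>x. (2 * (norm u)\<^sup>2 + 2 * (norm P)\<^sup>2 * (norm x)\<^sup>2)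
          + (2 * (norm w)\<^sup>2 + 2 * (norm Q)\<^sup>2 * (norm x)\<^sup>2))"
    using sq by (intro Bochner_Integration.integrable_add integrable_mult_right) auto
  then show ?thesis
  proof (rule Bochner_Integration.integrable_bound)
    have "(\<lambda>x. (u + P x) \<bullet> (w + Q x)) \<in> borel_measurable borel"
      by (intro borel_measurable_continuous_onI continuous_intros)
    then show "(\<lambda>x. (u + P x) \<bullet> (w + Q x)) \<in> borel_measurable M"
      unfolding measurable_cong_sets[OF sets refl] by (rule measurable_restrict_space1)
    have "norm ((u + P x) \<bullet> (w + Q x)) \<le> (norm (u + P x))\<^sup>2 + (norm (w + Q x))\<^sup>2" for x
    proof -
      have "\<bar>(u + P x) \<bullet> (w + Q x)\<bar> \<le> norm (u + P x) * norm (w + Q x)"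
        by (rule Cauchy_Schwarz_ineq2)
      moreover have "2 * (norm (u + P x) * norm (w + Q x)) \<le> (norm (u + P x))\<^sup>2 + (norm (w + Q x))\<^sup>2"
        using sum_squares_bound[of "norm (u + P x)" "norm (w + Q x)"] by simp
      moreover have "0 \<le> norm (u + P x) * norm (w + Q x)" by simp
      ultimately show ?thesis unfolding real_norm_def by linarith
    qed
    then show "AE x in M. norm ((u + P x) \<bullet> (w + Q x))
        \<le> norm ((2 * (norm u)\<^sup>2 + 2 * (norm P)\<^sup>2 * (norm x)\<^sup>2)
          + (2 * (norm w)\<^sup>2 + 2 * (norm Q)\<^sup>2 * (norm x)\<^sup>2))"
      using bound[of u P] bound[of w Q]
      by (intro AE_I2) (smt (verit, ccfv_SIG) real_norm_def)
  qed
qed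

lemma measurable_into_borel:
  "f \<in> M \<rightarrow>\<^sub>M borel_of X \<Longrightarrow> f \<in> M \<rightarrow>\<^sub>M borel"
  by (simp add: measurable_restrict_space2_iff)

lemma distr_pair_coupling:
  fixes M :: "'a measure" and X :: "'h::euclidean_space set"
  assumes "prob_space M" and [measurable]: "F \<in> M \<rightarrow>\<^sub>M borel_of X" "F' \<in> M \<rightarrow>\<^sub>M borel_of X"
  defines "\<Gamma> \<equiv> distr M (borel_of X \<Otimes>\<^sub>M borel_of X) (\<lambda>x. (F x, F' x))"
  shows "\<Gamma> \<in> couplings X (distr M (borel_of X) F) (distr M (borel_of X) F')"
    and "kantorovich_cost sq_dist_cost \<Gamma> = (\<integral>\<^sup>+x. ennreal (sq_dist_cost (F x) (F' x)) \<partial>M)"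
proof -
  interpret prob_space M by fact
  show "\<Gamma> \<in> couplings X (distr M (borel_of X) F) (distr M (borel_of X) F')"
    unfolding couplings_def \<Gamma>_def
    by (auto simp: distr_distr comp_def intro!: prob_space_distr)
  have [measurable]: "fst \<in> borel_of X \<Otimes>\<^sub>M borel_of X \<rightarrow>\<^sub>M borel"
      "snd \<in> borel_of X \<Otimes>\<^sub>M borel_of X \<rightarrow>\<^sub>M borel"
    by (auto intro!: measurable_into_borel)
  show "kantorovich_cost sq_dist_cost \<Gamma> = (\<integral>\<^sup>+x. ennreal (sq_dist_cost (F x) (F' x)) \<partial>M)"
    unfolding kantorovich_cost_def \<Gamma>_def sq_dist_cost_def split_beta
    by (subst nn_integral_distr) auto
qed

text \<open>The quadratic function q below is twice the defect in Young's inequality for the convex potential with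
gradient T. Splitting it off from the cost leaves the terms f and g, whose integrals are the same for
all couplings; the plan carried by the graph of T is the one with defect zero.\<close>
lemma affine_plan_optimal:
  fixes X :: "'h::euclidean_space set" and A B :: "'h \<Rightarrow>\<^sub>L 'h"
  assumes "prob_space \<mu>" and sets_\<mu>: "sets \<mu> = sets (borel_of X)"
    and sq: "integrable \<mu> (\<lambda>x. (norm x)\<^sup>2)"
    and A: "self_adjoint A" "positive_definite A"
    and AB: "A o\<^sub>L B = id_blinfun" "B o\<^sub>L A = id_blinfun"
    and T: "T \<in> borel_of X \<rightarrow>\<^sub>M borel_of X" and T_eq: "\<And>x. x \<in> X \<Longrightarrow> T x = v + A x"
    and \<Gamma>: "\<Gamma> \<in> couplings X \<mu> (distr \<mu> (borel_of X) T)"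
  defines "\<Gamma>\<^sub>T \<equiv> distr \<mu> (borel_of X \<Otimes>\<^sub>M borel_of X) (\<lambda>x. (x, T x))"
  shows "kantorovich_cost sq_dist_cost \<Gamma>\<^sub>T \<le> kantorovich_cost sq_dist_cost \<Gamma>"
    and "kantorovich_cost sq_dist_cost \<Gamma> \<le> kantorovich_cost sq_dist_cost \<Gamma>\<^sub>T \<Longrightarrow> \<Gamma> = \<Gamma>\<^sub>T"
proof -
  let ?X2 = "borel_of X \<Otimes>\<^sub>M borel_of X"
  let ?\<nu> = "distr \<mu> (borel_of X) T"
  interpret \<mu>: prob_space \<mu> by fact
  have space_\<mu>: "space \<mu> = X" using sets_eq_imp_space_eq[OF sets_\<mu>] by (simp add: space_restrict_space)
  have T\<mu> [measurable]: "T \<in> \<mu> \<rightarrow>\<^sub>M borel_of X"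
    using T sets_\<mu> by (simp cong: measurable_cong_sets)
  have id\<mu> [measurable]: "(\<lambda>x. x) \<in> \<mu> \<rightarrow>\<^sub>M borel_of X"
    using sets_\<mu> by (simp add: measurable_ident_sets)
  interpret \<nu>: prob_space ?\<nu> by (rule \<mu>.prob_space_distr[OF T\<mu>])
  define q where "q p = (snd p - (v + A (fst p))) \<bullet> B (snd p - (v + A (fst p)))" for p
  define f where "f x = (norm x)\<^sup>2 - (2 *\<^sub>R v + A x) \<bullet> x" for x
  define g where "g y = (norm y)\<^sup>2 - (y - v) \<bullet> B (y - v)" for y
  note B = inverse_self_adjoint_positive_definite[OF A AB(1)]
  have AB': "A (B x) = x" "B (A x) = x" for x
    using AB by (metis blinfun_apply_blinfun_compose id_blinfun.rep_eq id_apply)+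
  have q_nonneg: "0 \<le> q p" for p
    using B(2) unfolding q_def positive_definite_def
    by (cases "snd p - (v + A (fst p)) = 0") (auto simp: less_imp_le)
  have q_0: "q p = 0 \<longleftrightarrow> snd p = v + A (fst p)" for p
    using B(2) unfolding q_def positive_definite_def
    by (cases "snd p - (v + A (fst p)) = 0") (auto simp: less_le)
  have decomp: "sq_dist_cost (fst p) (snd p) = f (fst p) + g (snd p) + q p" for p
  proof -
    define x y w where "x = fst p" and "y = snd p" and "w = y - v"
    have "q p = (w - A x) \<bullet> B (w - A x)" by (simp add: q_def x_def y_def w_def algebra_simps)
    also have "\<dots> = w \<bullet> B w - w \<bullet> x - A x \<bullet> B w + A x \<bullet> x"
      by (simp add: blinfun.diff_right inner_diff AB')
    also have "A x \<bullet> B w = x \<bullet> w"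
      using A(1) AB'(1) unfolding self_adjoint_inner by metis
    finally have "q p = w \<bullet> B w - 2 * (x \<bullet> w) + A x \<bullet> x" by (simp add: inner_commute)
    moreover have "(norm (x - y))\<^sup>2 = (norm x)\<^sup>2 + (norm y)\<^sup>2 - 2 * (x \<bullet> y)"
      by (simp add: power2_norm_eq_inner inner_diff inner_commute)
    moreover have "x \<bullet> w = x \<bullet> y - v \<bullet> x" by (simp add: w_def inner_diff inner_commute)
    ultimately show ?thesis
      by (simp add: sq_dist_cost_def f_def g_def flip: x_def y_def w_def) (simp add: inner_add_left)
  qed
  have sq_\<nu>: "integrable ?\<nu> (\<lambda>y. (norm y)\<^sup>2)"
  proof (subst integrable_distr_eq[OF T\<mu>])
    show "(\<lambda>y. (norm y)\<^sup>2) \<in> borel_measurable (borel_of X)"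
      by (intro measurable_restrict_space1) simp
    have "integrable \<mu> (\<lambda>x. (v + A x) \<bullet> (v + A x))"
      by (rule integrable_inner_affine[OF \<mu>.finite_measure_axioms sets_\<mu> sq])
    then show "integrable \<mu> (\<lambda>x. (norm (T x))\<^sup>2)"
      by (rule Bochner_Integration.integrable_cong[THEN iffD1, rotated -1])
        (simp_all add: T_eq space_\<mu> power2_norm_eq_inner)
  qed
  have int_f: "integrable \<mu> f"
    using integrable_inner_affine[OF \<mu>.finite_measure_axioms sets_\<mu> sq, of "2 *\<^sub>R v" A 0 id_blinfun] sq
    unfolding f_def by simp
  have int_g: "integrable ?\<nu> g"
    using integrable_inner_affine[OF \<nu>.finite_measure_axioms _ sq_\<nu>, of X "- v" id_blinfun "- B v" B] sq_\<nu>
    unfolding g_def by (simp add: blinfun.diff_right)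
  define C where "C = (\<integral>x. f x \<partial>\<mu>) + (\<integral>y. g y \<partial>?\<nu>)"
  \<comment> \<open>nonnegativity of the real value is recorded because \<open>ennreal\<close> truncates negative numbers\<close>
  have cost: "integrable \<Gamma>' q \<and> kantorovich_cost sq_dist_cost \<Gamma>' = ennreal (C + (\<integral>p. q p \<partial>\<Gamma>')) \<and> 0 \<le> C + (\<integral>p. q p \<partial>\<Gamma>')"
    if "\<Gamma>' \<in> couplings X \<mu> ?\<nu>" for \<Gamma>'
  proof -
    have sets': "sets \<Gamma>' = sets ?X2"
      and fst': "distr \<Gamma>' (borel_of X) fst = \<mu>" and snd': "distr \<Gamma>' (borel_of X) snd = ?\<nu>"
      using that by (auto simp: couplings_def)
    have m [measurable]: "fst \<in> \<Gamma>' \<rightarrow>\<^sub>M borel_of X" "snd \<in> \<Gamma>' \<rightarrow>\<^sub>M borel_of X"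
      by (simp_all add: measurable_cong_sets[OF sets' refl])
    have [measurable]: "fst \<in> \<Gamma>' \<rightarrow>\<^sub>M borel" "snd \<in> \<Gamma>' \<rightarrow>\<^sub>M borel"
      using m by (blast intro: measurable_into_borel)+
    have push1: "integrable \<Gamma>' (\<lambda>p. k (fst p)) \<and> (\<integral>p. k (fst p) \<partial>\<Gamma>') = (\<integral>x. k x \<partial>\<mu>)"
      if "integrable \<mu> k" for k :: "'h \<Rightarrow> real"
    proof -
      have k: "k \<in> borel_measurable (borel_of X)"
        using borel_measurable_integrable[OF that] by (simp add: measurable_cong_sets[OF sets_\<mu> refl])
      show ?thesis
        using that integrable_distr_eq[OF m(1) k] integral_distr[OF m(1) k] by (simp add: fst')
    qed
    have push2: "integrable \<Gamma>' (\<lambda>p. k (snd p)) \<and> (\<integral>p. k (snd p) \<partial>\<Gamma>') = (\<integral>y. k y \<partial>?\<nu>)"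
      if "integrable ?\<nu> k" for k :: "'h \<Rightarrow> real"
    proof -
      have k: "k \<in> borel_measurable (borel_of X)"
        using borel_measurable_integrable[OF that] by simp
      show ?thesis
        using that integrable_distr_eq[OF m(2) k] integral_distr[OF m(2) k] by (simp add: snd')
    qed
    have int_c: "integrable \<Gamma>' (\<lambda>p. sq_dist_cost (fst p) (snd p))"
    proof (rule Bochner_Integration.integrable_bound)
      show "integrable \<Gamma>' (\<lambda>p. 2 * (norm (fst p))\<^sup>2 + 2 * (norm (snd p))\<^sup>2)"
        using push1[OF sq] push2[OF sq_\<nu>] by simp
      show "(\<lambda>p. sq_dist_cost (fst p) (snd p)) \<in> borel_measurable \<Gamma>'"
        unfolding sq_dist_cost_def by measurable
      have "(norm (x - y))\<^sup>2 \<le> 2 * (norm x)\<^sup>2 + 2 * (norm y)\<^sup>2" for x y :: 'h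
        using inner_ge_zero[of "x + y"] unfolding power2_norm_eq_inner
        by (simp add: inner_add inner_diff inner_commute)
      then show "AE p in \<Gamma>'. norm (sq_dist_cost (fst p) (snd p))
          \<le> norm (2 * (norm (fst p))\<^sup>2 + 2 * (norm (snd p))\<^sup>2)"
        by (simp add: sq_dist_cost_def)
    qed
    have q_eq: "q = (\<lambda>p. sq_dist_cost (fst p) (snd p) - f (fst p) - g (snd p))"
      by (rule ext) (simp add: decomp)
    have int_q: "integrable \<Gamma>' q"
      unfolding q_eq using int_c push1[OF int_f] push2[OF int_g] by simp
    have val: "(\<integral>p. sq_dist_cost (fst p) (snd p) \<partial>\<Gamma>') = C + (\<integral>p. q p \<partial>\<Gamma>')"
      unfolding decomp C_def using int_q push1[OF int_f] push2[OF int_g] by simp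
    have "kantorovich_cost sq_dist_cost \<Gamma>' = ennreal (\<integral>p. sq_dist_cost (fst p) (snd p) \<partial>\<Gamma>')"
      unfolding kantorovich_cost_def split_beta
      by (rule nn_integral_eq_integral[OF int_c]) (simp add: sq_dist_cost_def)
    moreover have "0 \<le> (\<integral>p. sq_dist_cost (fst p) (snd p) \<partial>\<Gamma>')"
      by (simp add: sq_dist_cost_def)
    ultimately show ?thesis using int_q val by simp
  qed
  have "\<Gamma>\<^sub>T \<in> couplings X (distr \<mu> (borel_of X) (\<lambda>x. x)) ?\<nu>"
    unfolding \<Gamma>\<^sub>T_def by (rule distr_pair_coupling(1)[OF \<open>prob_space \<mu>\<close> id\<mu> T\<mu>])
  moreover have "distr \<mu> (borel_of X) (\<lambda>x. x) = \<mu>"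
    by (rule distr_id2[OF sets_\<mu>[symmetric]])
  ultimately have \<Gamma>T: "\<Gamma>\<^sub>T \<in> couplings X \<mu> ?\<nu>" by simp
  have pairT: "(\<lambda>x. (x, T x)) \<in> borel_of X \<rightarrow>\<^sub>M ?X2" using T by simp
  have qm: "q \<in> borel_measurable ?X2"
  proof -
    have [measurable]: "fst \<in> ?X2 \<rightarrow>\<^sub>M borel" "snd \<in> ?X2 \<rightarrow>\<^sub>M borel"
      by (auto intro!: measurable_into_borel)
    have [measurable]: "blinfun_apply A \<in> borel_measurable borel" "blinfun_apply B \<in> borel_measurable borel"
      by (intro borel_measurable_continuous_onI continuous_intros)+
    show ?thesis unfolding q_def by measurable
  qed
  have "(\<integral>p. q p \<partial>\<Gamma>\<^sub>T) = (\<integral>x. q (x, T x) \<partial>\<mu>)"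
    unfolding \<Gamma>\<^sub>T_def by (rule integral_distr[OF _ qm]) measurable
  also have "\<dots> = (\<integral>x. 0 \<partial>\<mu>)"
    by (rule Bochner_Integration.integral_cong) (simp_all add: space_\<mu> T_eq q_0)
  finally have zero: "(\<integral>p. q p \<partial>\<Gamma>\<^sub>T) = 0" by simp
  show "kantorovich_cost sq_dist_cost \<Gamma>\<^sub>T \<le> kantorovich_cost sq_dist_cost \<Gamma>"
    using cost[OF \<Gamma>] cost[OF \<Gamma>T] zero Bochner_Integration.integral_nonneg[of \<Gamma> q] q_nonneg
    by (simp add: ennreal_leI)
  assume "kantorovich_cost sq_dist_cost \<Gamma> \<le> kantorovich_cost sq_dist_cost \<Gamma>\<^sub>T"
  then have "(\<integral>p. q p \<partial>\<Gamma>) \<le> 0"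
    using cost[OF \<Gamma>] cost[OF \<Gamma>T] zero by (simp add: ennreal_le_iff)
  then have "(\<integral>p. q p \<partial>\<Gamma>) = 0"
    using Bochner_Integration.integral_nonneg[of \<Gamma> q] q_nonneg by (intro antisym) simp_all
  then have AEq: "AE p in \<Gamma>. q p = 0"
    using cost[OF \<Gamma>] q_nonneg by (subst (asm) integral_nonneg_eq_0_iff_AE) auto
  have sets_\<Gamma>: "sets \<Gamma> = sets ?X2" and fst_\<Gamma>: "distr \<Gamma> (borel_of X) fst = \<mu>"
    using \<Gamma> by (auto simp: couplings_def)
  have space_\<Gamma>: "space \<Gamma> = X \<times> X"
    using sets_eq_imp_space_eq[OF sets_\<Gamma>] by (simp add: space_pair_measure space_restrict_space)
  have fst_m: "fst \<in> \<Gamma> \<rightarrow>\<^sub>M borel_of X" by (simp add: measurable_cong_sets[OF sets_\<Gamma> refl])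
  have m': "(\<lambda>p. (fst p, T (fst p))) \<in> \<Gamma> \<rightarrow>\<^sub>M ?X2"
    using measurable_compose[OF fst_m pairT] .
  have "\<Gamma> = distr \<Gamma> ?X2 (\<lambda>p. p)"
    by (rule distr_id2[OF sets_\<Gamma>[symmetric], symmetric])
  also have "\<dots> = distr \<Gamma> ?X2 (\<lambda>p. (fst p, T (fst p)))"
  proof (rule distr_cong_AE)
    show "AE p in \<Gamma>. p = (fst p, T (fst p))"
      using AEq AE_space
    proof eventually_elim
      case (elim p)
      then show ?case by (auto simp: q_0 space_\<Gamma> T_eq prod_eq_iff)
    qed
  qed (use m' in \<open>simp_all add: measurable_ident_sets sets_\<Gamma>\<close>)
  also have "\<dots> = distr (distr \<Gamma> (borel_of X) fst) ?X2 (\<lambda>x. (x, T x))"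
    by (subst distr_distr[OF pairT fst_m]) (simp add: comp_def)
  also have "\<dots> = \<Gamma>\<^sub>T" by (simp add: fst_\<Gamma> \<Gamma>\<^sub>T_def)
  finally show "\<Gamma> = \<Gamma>\<^sub>T" .
qed

theorem theorem4p3:
  fixes X :: "'h::euclidean_space set"
    and \<rho> \<mu>\<^sub>0 \<mu>\<^sub>1 :: "'h measure"
    and G :: "('g, 'm) monoid_scheme"
    and M\<^sub>G :: "('g, 'e::real_normed_vector) mfd"
    and \<alpha> :: "'g \<Rightarrow> 'h \<Rightarrow> 'h"
    and b :: "'g \<Rightarrow> 'h"
    and \<pi> :: "'g \<Rightarrow> 'h \<Rightarrow>\<^sub>L 'h"
    and g\<^sub>0 g\<^sub>1 :: 'g
    and L :: "('h \<Rightarrow>\<^sub>L 'h) set"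
    and M\<^sub>L :: "('h \<Rightarrow>\<^sub>L 'h, 'f::real_normed_vector) mfd"
    and \<theta> :: "('h \<Rightarrow>\<^sub>L 'h) \<Rightarrow> ('h \<Rightarrow>\<^sub>L 'h)"
  assumes "open X" and "convex X" and "X \<noteq> {}"
    and "\<rho> \<in> borel_prob_measures X"
    and "absolutely_continuous (restrict_space lborel X) \<rho>"
    and "(\<integral>\<^sup>+x. ennreal ((norm x)\<^sup>2) \<partial>\<rho>) < \<infinity>"
    and "lie_group G M\<^sub>G"
    and "smooth_action G M\<^sub>G X \<alpha>"
    and "induced_by_affine_rep G X \<alpha> b \<pi>"
    and "g\<^sub>0 \<in> carrier G" and "g\<^sub>1 \<in> carrier G"
    and "\<mu>\<^sub>0 = distr \<rho> (borel_of X) (\<alpha> g\<^sub>0)"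
    and "\<mu>\<^sub>1 = distr \<rho> (borel_of X) (\<alpha> g\<^sub>1)"
    and "L = \<pi> ` carrier G"
    and "global_cartan_decomposition L M\<^sub>L \<theta>"
    and "\<forall>S\<in>cartan_p M\<^sub>L \<theta>. self_adjoint S"
    and "fixed_subgroup L \<theta> \<subseteq> \<pi> ` stabilizer G X \<alpha> \<rho>"
  shows "\<exists>h\<in>stabilizer G X \<alpha> \<rho>.
    \<pi> h \<in> fixed_subgroup L \<theta> \<and>
    (let g = g\<^sub>1 \<otimes>\<^bsub>G\<^esub> h \<otimes>\<^bsub>G\<^esub> inv\<^bsub>G\<^esub> g\<^sub>0;
         T = \<alpha> g;
         \<Gamma> = distr \<mu>\<^sub>0 (borel_of X \<Otimes>\<^sub>M borel_of X) (\<lambda>x. (x, T x))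
     in
       (self_adjoint (\<pi> g) \<and> positive_definite (\<pi> g)) \<and>
       (solves_monge X sq_dist_cost \<mu>\<^sub>0 \<mu>\<^sub>1 T \<and>
        (\<forall>T'. solves_monge X sq_dist_cost \<mu>\<^sub>0 \<mu>\<^sub>1 T' \<longrightarrow> (AE x in \<mu>\<^sub>0. T' x = T x))) \<and>
       (solves_kantorovich X sq_dist_cost \<mu>\<^sub>0 \<mu>\<^sub>1 \<Gamma> \<and>
        (\<forall>\<Gamma>'. solves_kantorovich X sq_dist_cost \<mu>\<^sub>0 \<mu>\<^sub>1 \<Gamma>' \<longrightarrow> \<Gamma>' = \<Gamma>)) \<and>
       orbit_cost G \<alpha> \<rho> sq_dist_cost g\<^sub>0 g\<^sub>1 h = orbit_transport G X \<alpha> \<rho> sq_dist_cost g\<^sub>0 g\<^sub>1 \<and>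
       (kantorovich X sq_dist_cost \<mu>\<^sub>0 \<mu>\<^sub>1 = monge X sq_dist_cost \<mu>\<^sub>0 \<mu>\<^sub>1 \<and>
        monge X sq_dist_cost \<mu>\<^sub>0 \<mu>\<^sub>1 = orbit_transport G X \<alpha> \<rho> sq_dist_cost g\<^sub>0 g\<^sub>1))"
proof -
  define BX where "BX = borel_of X"
  define K where "K = fixed_subgroup L \<theta>"
  interpret G: group G using assms(7) by (simp add: lie_group_def)
  interpret GL: group "GL :: ('h \<Rightarrow>\<^sub>L 'h) monoid" by (rule group_GL)
  have \<rho>: "prob_space \<rho>" and sets_\<rho>: "sets \<rho> = sets BX"
    using assms(4) by (auto simp: borel_prob_measures_def BX_def)
  interpret \<rho>: prob_space \<rho> by fact
  have space_\<rho>: "space \<rho> = X"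
    using sets_eq_imp_space_eq[OF sets_\<rho>] by (simp add: space_restrict_space BX_def)
  have \<pi>_GL: "\<pi> g \<in> carrier GL"
    and \<alpha>_eq: "x \<in> X \<Longrightarrow> \<alpha> g x = b g + \<pi> g x"
    and \<alpha>_X: "x \<in> X \<Longrightarrow> \<alpha> g x \<in> X" if "g \<in> carrier G" for g x
    using assms(9) that by (auto simp: induced_by_affine_rep_def)
  have \<pi>_mult: "\<pi> (g \<otimes>\<^bsub>G\<^esub> g') = \<pi> g o\<^sub>L \<pi> g'" if "g \<in> carrier G" "g' \<in> carrier G" for g g'
    using assms(9) that by (auto simp: induced_by_affine_rep_def)
  interpret \<pi>: group_hom G GL \<pi>
    by unfold_locales (simp add: hom_def \<pi>_GL \<pi>_mult)
  have \<alpha>_mult: "\<alpha> (g \<otimes>\<^bsub>G\<^esub> g') x = \<alpha> g (\<alpha> g' x)" if "g \<in> carrier G" "g' \<in> carrier G" "x \<in> X" for g g' x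
    using assms(8) that by (auto simp: smooth_action_def)
  have \<alpha>_meas: "\<alpha> g \<in> BX \<rightarrow>\<^sub>M BX" if "g \<in> carrier G" for g
    unfolding BX_def
  proof (rule measurable_restrict_space2)
    show "\<alpha> g \<in> space (borel_of X) \<rightarrow> X"
      using \<alpha>_X[OF that] by (simp add: space_restrict_space)
    have "(\<lambda>x. b g + \<pi> g x) \<in> borel_measurable (borel_of X)"
      by (intro measurable_restrict_space1 borel_measurable_continuous_onI continuous_intros)
    then show "\<alpha> g \<in> borel_measurable (borel_of X)"
      by (rule measurable_cong[THEN iffD2, rotated])
        (simp add: space_restrict_space \<alpha>_eq[OF that])
  qed
  have meas: "\<alpha> g \<in> \<rho> \<rightarrow>\<^sub>M BX" if "g \<in> carrier G" for g
    using \<alpha>_meas[OF that] by (simp add: measurable_cong_sets[OF sets_\<rho> refl])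
  have push: "distr \<rho> BX (\<alpha> (g \<otimes>\<^bsub>G\<^esub> g')) = distr (distr \<rho> BX (\<alpha> g')) BX (\<alpha> g)"
    if "g \<in> carrier G" "g' \<in> carrier G" for g g'
    using that by (subst distr_distr) (auto simp: \<alpha>_meas meas space_\<rho> \<alpha>_mult intro!: distr_cong)
  have stab: "distr \<rho> BX (\<alpha> h) = \<rho>" "h \<in> carrier G" if "h \<in> stabilizer G X \<alpha> \<rho>" for h
    using that by (auto simp: stabilizer_def BX_def)
  have \<mu>\<^sub>1_eq: "distr \<rho> BX (\<alpha> (g\<^sub>1 \<otimes>\<^bsub>G\<^esub> h)) = \<mu>\<^sub>1" if "h \<in> stabilizer G X \<alpha> \<rho>" for h
    using push[OF assms(11) stab(2)[OF that]] stab(1)[OF that] assms(13) by (simp add: BX_def)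

  \<comment> \<open>choice of h: align the linear parts inside the fixed subgroup, then lift to the stabilizer\<close>
  obtain k where k: "k \<in> K"
    and spd: "self_adjoint (\<pi> g\<^sub>1 o\<^sub>L k o\<^sub>L inv\<^bsub>GL\<^esub> \<pi> g\<^sub>0)" "positive_definite (\<pi> g\<^sub>1 o\<^sub>L k o\<^sub>L inv\<^bsub>GL\<^esub> \<pi> g\<^sub>0)"
    using cartan_positive_definite_alignment[OF assms(15,16), of "\<pi> g\<^sub>0" "\<pi> g\<^sub>1"] assms(10,11,14)
    unfolding K_def by blast
  then obtain h where h: "h \<in> stabilizer G X \<alpha> \<rho>" "\<pi> h = k"
    using assms(17) by (auto simp: K_def)
  define g where "g = g\<^sub>1 \<otimes>\<^bsub>G\<^esub> h \<otimes>\<^bsub>G\<^esub> inv\<^bsub>G\<^esub> g\<^sub>0"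
  define T where "T = \<alpha> g"
  define \<Gamma> where "\<Gamma> = distr \<mu>\<^sub>0 (BX \<Otimes>\<^sub>M BX) (\<lambda>x. (x, T x))"
  have hG: "h \<in> carrier G" and g1h: "g\<^sub>1 \<otimes>\<^bsub>G\<^esub> h \<in> carrier G" and gG: "g \<in> carrier G"
    using stab(2)[OF h(1)] assms(10,11) by (auto simp: g_def)
  have \<pi>_g: "\<pi> g = \<pi> g\<^sub>1 o\<^sub>L k o\<^sub>L inv\<^bsub>GL\<^esub> \<pi> g\<^sub>0"
    using assms(10,11) hG h(2) by (simp add: g_def \<pi>_mult \<pi>.hom_inv)
  note spd' = spd[folded \<pi>_g]
  have gg0: "g \<otimes>\<^bsub>G\<^esub> g\<^sub>0 = g\<^sub>1 \<otimes>\<^bsub>G\<^esub> h"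
    using assms(10) g1h by (simp add: g_def G.m_assoc)
  have T_meas: "T \<in> BX \<rightarrow>\<^sub>M BX" unfolding T_def by (rule \<alpha>_meas[OF gG])
  have \<mu>0: "\<mu>\<^sub>0 = distr \<rho> BX (\<alpha> g\<^sub>0)" using assms(12) by (simp add: BX_def)
  have T_push: "distr \<mu>\<^sub>0 BX T = \<mu>\<^sub>1"
    using push[OF gG assms(10)] \<mu>\<^sub>1_eq[OF h(1)] gg0 by (simp add: T_def \<mu>0)
  have sets_\<mu>0: "sets \<mu>\<^sub>0 = sets BX" by (simp add: \<mu>0)
  have space_\<mu>0: "space \<mu>\<^sub>0 = X" by (simp add: \<mu>0 BX_def space_restrict_space)
  interpret \<mu>0: prob_space \<mu>\<^sub>0 unfolding \<mu>0 by (rule \<rho>.prob_space_distr[OF meas[OF assms(10)]])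
  have norm_meas: "(\<lambda>x. (norm x)\<^sup>2) \<in> borel_measurable BX"
    unfolding BX_def by (intro measurable_restrict_space1) simp
  have sq_\<rho>: "integrable \<rho> (\<lambda>x. (norm x)\<^sup>2)"
    using assms(6) norm_meas
    by (intro integrableI_bounded) (simp_all add: measurable_cong_sets[OF sets_\<rho> refl])
  have sq_\<mu>0: "integrable \<mu>\<^sub>0 (\<lambda>x. (norm x)\<^sup>2)"
    unfolding \<mu>0
  proof (subst integrable_distr_eq[OF meas[OF assms(10)] norm_meas])
    have "integrable \<rho> (\<lambda>x. (b g\<^sub>0 + \<pi> g\<^sub>0 x) \<bullet> (b g\<^sub>0 + \<pi> g\<^sub>0 x))"
      by (rule integrable_inner_affine[OF \<rho>.finite_measure_axioms sets_\<rho>[unfolded BX_def] sq_\<rho>])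
    then show "integrable \<rho> (\<lambda>x. (norm (\<alpha> g\<^sub>0 x))\<^sup>2)"
      by (rule Bochner_Integration.integrable_cong[THEN iffD1, rotated -1])
        (simp_all add: \<alpha>_eq[OF assms(10)] space_\<rho> power2_norm_eq_inner)
  qed
  obtain B where B: "\<pi> g o\<^sub>L B = id_blinfun" "B o\<^sub>L \<pi> g = id_blinfun"
    using \<pi>_GL[OF gG] by (auto simp: GL_def)
  have T_eq: "T x = b g + \<pi> g x" if "x \<in> X" for x
    using \<alpha>_eq[OF gG that] by (simp add: T_def)

  let ?C = "couplings X \<mu>\<^sub>0 \<mu>\<^sub>1"
  have optimal: "kantorovich_cost sq_dist_cost \<Gamma> \<le> kantorovich_cost sq_dist_cost \<Gamma>'"
      "kantorovich_cost sq_dist_cost \<Gamma>' \<le> kantorovich_cost sq_dist_cost \<Gamma> \<Longrightarrow> \<Gamma>' = \<Gamma>"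
    if "\<Gamma>' \<in> ?C" for \<Gamma>'
  proof -
    have "\<Gamma>' \<in> couplings X \<mu>\<^sub>0 (distr \<mu>\<^sub>0 (borel_of X) T)"
      using that T_push by (simp add: BX_def)
    note * = affine_plan_optimal[OF \<mu>0.prob_space_axioms sets_\<mu>0[unfolded BX_def] sq_\<mu>0 spd' B
        T_meas[unfolded BX_def] _ this, of "b g", folded BX_def, folded \<Gamma>_def]
    show "kantorovich_cost sq_dist_cost \<Gamma> \<le> kantorovich_cost sq_dist_cost \<Gamma>'"
      by (rule *(1)) (rule T_eq)
    show "\<Gamma>' = \<Gamma>" if "kantorovich_cost sq_dist_cost \<Gamma>' \<le> kantorovich_cost sq_dist_cost \<Gamma>"
      by (rule *(2)) (rule T_eq that | assumption)+
  qed
  have plan: "distr \<mu>\<^sub>0 (BX \<Otimes>\<^sub>M BX) (\<lambda>x. (x, T' x)) \<in> ?C"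
      "kantorovich_cost sq_dist_cost (distr \<mu>\<^sub>0 (BX \<Otimes>\<^sub>M BX) (\<lambda>x. (x, T' x))) = monge_cost sq_dist_cost \<mu>\<^sub>0 T'"
    if T': "T' \<in> transport_maps X \<mu>\<^sub>0 \<mu>\<^sub>1" for T'
  proof -
    have m: "T' \<in> \<mu>\<^sub>0 \<rightarrow>\<^sub>M borel_of X" "(\<lambda>x. x) \<in> \<mu>\<^sub>0 \<rightarrow>\<^sub>M borel_of X"
      using T' sets_\<mu>0 by (auto simp: transport_maps_def BX_def measurable_ident_sets cong: measurable_cong_sets)
    have "distr \<mu>\<^sub>0 (borel_of X) (\<lambda>x. x) = \<mu>\<^sub>0"
      using sets_\<mu>0 by (intro distr_id2) (simp add: BX_def)
    then show "distr \<mu>\<^sub>0 (BX \<Otimes>\<^sub>M BX) (\<lambda>x. (x, T' x)) \<in> ?C"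
      "kantorovich_cost sq_dist_cost (distr \<mu>\<^sub>0 (BX \<Otimes>\<^sub>M BX) (\<lambda>x. (x, T' x))) = monge_cost sq_dist_cost \<mu>\<^sub>0 T'"
      using distr_pair_coupling[OF \<mu>0.prob_space_axioms m(2,1)] T'
      by (simp_all add: transport_maps_def BX_def monge_cost_def)
  qed
  have T_tm: "T \<in> transport_maps X \<mu>\<^sub>0 \<mu>\<^sub>1"
    using T_meas T_push by (simp add: transport_maps_def BX_def)
  have orbit: "distr \<rho> (BX \<Otimes>\<^sub>M BX) (\<lambda>x. (\<alpha> g\<^sub>0 x, \<alpha> (g\<^sub>1 \<otimes>\<^bsub>G\<^esub> h') x)) \<in> ?C"
      "kantorovich_cost sq_dist_cost (distr \<rho> (BX \<Otimes>\<^sub>M BX) (\<lambda>x. (\<alpha> g\<^sub>0 x, \<alpha> (g\<^sub>1 \<otimes>\<^bsub>G\<^esub> h') x)))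
        = orbit_cost G \<alpha> \<rho> sq_dist_cost g\<^sub>0 g\<^sub>1 h'"
    if h': "h' \<in> stabilizer G X \<alpha> \<rho>" for h'
  proof -
    have "g\<^sub>1 \<otimes>\<^bsub>G\<^esub> h' \<in> carrier G" using stab(2)[OF h'] assms(11) by simp
    note distr_pair_coupling[OF \<rho> meas[OF assms(10), unfolded BX_def] meas[OF this, unfolded BX_def]]
    with \<mu>\<^sub>1_eq[OF h'] \<mu>0
    show "distr \<rho> (BX \<Otimes>\<^sub>M BX) (\<lambda>x. (\<alpha> g\<^sub>0 x, \<alpha> (g\<^sub>1 \<otimes>\<^bsub>G\<^esub> h') x)) \<in> ?C"
      "kantorovich_cost sq_dist_cost (distr \<rho> (BX \<Otimes>\<^sub>M BX) (\<lambda>x. (\<alpha> g\<^sub>0 x, \<alpha> (g\<^sub>1 \<otimes>\<^bsub>G\<^esub> h') x)))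
        = orbit_cost G \<alpha> \<rho> sq_dist_cost g\<^sub>0 g\<^sub>1 h'"
      by (simp_all add: BX_def orbit_cost_def)
  qed
  \<comment> \<open>the coupling induced by h itself is the plan carried by the graph of T\<close>
  have "distr \<rho> (BX \<Otimes>\<^sub>M BX) (\<lambda>x. (\<alpha> g\<^sub>0 x, \<alpha> (g\<^sub>1 \<otimes>\<^bsub>G\<^esub> h) x)) = \<Gamma>"
  proof -
    have "(\<lambda>x. (x, T x)) \<in> BX \<rightarrow>\<^sub>M BX \<Otimes>\<^sub>M BX" using T_meas by simp
    then have "\<Gamma> = distr \<rho> (BX \<Otimes>\<^sub>M BX) (\<lambda>x. (\<alpha> g\<^sub>0 x, T (\<alpha> g\<^sub>0 x)))"
      unfolding \<Gamma>_def \<mu>0 by (subst distr_distr[OF _ meas[OF assms(10)]]) (simp_all add: comp_def)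
    also have "\<dots> = distr \<rho> (BX \<Otimes>\<^sub>M BX) (\<lambda>x. (\<alpha> g\<^sub>0 x, \<alpha> (g\<^sub>1 \<otimes>\<^bsub>G\<^esub> h) x))"
      by (rule distr_cong) (simp_all add: T_def space_\<rho> \<alpha>_mult[OF gG assms(10)] flip: gg0)
    finally show ?thesis ..
  qed
  then have orbit_h: "orbit_cost G \<alpha> \<rho> sq_dist_cost g\<^sub>0 g\<^sub>1 h = kantorovich_cost sq_dist_cost \<Gamma>"
    using orbit(2)[OF h(1)] by simp
  have \<Gamma>_C: "\<Gamma> \<in> ?C" and cost_T: "kantorovich_cost sq_dist_cost \<Gamma> = monge_cost sq_dist_cost \<mu>\<^sub>0 T"
    using plan[OF T_tm] by (simp_all add: \<Gamma>_def)

  have kan: "kantorovich X sq_dist_cost \<mu>\<^sub>0 \<mu>\<^sub>1 = kantorovich_cost sq_dist_cost \<Gamma>"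
    unfolding kantorovich_def
  proof (rule antisym)
    show "(INF \<Gamma>\<in>?C. kantorovich_cost sq_dist_cost \<Gamma>) \<le> kantorovich_cost sq_dist_cost \<Gamma>"
      by (rule INF_lower[OF \<Gamma>_C])
    show "kantorovich_cost sq_dist_cost \<Gamma> \<le> (INF \<Gamma>\<in>?C. kantorovich_cost sq_dist_cost \<Gamma>)"
      by (rule INF_greatest) (rule optimal(1))
  qed
  have mon: "monge X sq_dist_cost \<mu>\<^sub>0 \<mu>\<^sub>1 = kantorovich_cost sq_dist_cost \<Gamma>"
    unfolding monge_def
  proof (rule antisym)
    show "(INF T\<in>transport_maps X \<mu>\<^sub>0 \<mu>\<^sub>1. monge_cost sq_dist_cost \<mu>\<^sub>0 T) \<le> kantorovich_cost sq_dist_cost \<Gamma>"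
      unfolding cost_T by (rule INF_lower[OF T_tm])
  next
    show "kantorovich_cost sq_dist_cost \<Gamma> \<le> (INF T\<in>transport_maps X \<mu>\<^sub>0 \<mu>\<^sub>1. monge_cost sq_dist_cost \<mu>\<^sub>0 T)"
    proof (rule INF_greatest)
      fix T' assume "T' \<in> transport_maps X \<mu>\<^sub>0 \<mu>\<^sub>1"
      from optimal(1)[OF plan(1)[OF this]] plan(2)[OF this]
      show "kantorovich_cost sq_dist_cost \<Gamma> \<le> monge_cost sq_dist_cost \<mu>\<^sub>0 T'" by simp
    qed
  qed
  have orb: "orbit_transport G X \<alpha> \<rho> sq_dist_cost g\<^sub>0 g\<^sub>1 = kantorovich_cost sq_dist_cost \<Gamma>"
    unfolding orbit_transport_def
  proof (rule antisym)
    show "(INF h\<in>stabilizer G X \<alpha> \<rho>. orbit_cost G \<alpha> \<rho> sq_dist_cost g\<^sub>0 g\<^sub>1 h) \<le> kantorovich_cost sq_dist_cost \<Gamma>"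
      unfolding orbit_h[symmetric] by (rule INF_lower[OF h(1)])
  next
    show "kantorovich_cost sq_dist_cost \<Gamma> \<le> (INF h\<in>stabilizer G X \<alpha> \<rho>. orbit_cost G \<alpha> \<rho> sq_dist_cost g\<^sub>0 g\<^sub>1 h)"
    proof (rule INF_greatest)
      fix h' assume "h' \<in> stabilizer G X \<alpha> \<rho>"
      from optimal(1)[OF orbit(1)[OF this]] orbit(2)[OF this]
      show "kantorovich_cost sq_dist_cost \<Gamma> \<le> orbit_cost G \<alpha> \<rho> sq_dist_cost g\<^sub>0 g\<^sub>1 h'" by simp
    qed
  qed
  have uniq_plan: "\<Gamma>' = \<Gamma>" if "solves_kantorovich X sq_dist_cost \<mu>\<^sub>0 \<mu>\<^sub>1 \<Gamma>'" for \<Gamma>'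
    using that optimal(2)[of \<Gamma>'] by (simp add: solves_kantorovich_def kan)
  have uniq_map: "AE x in \<mu>\<^sub>0. T' x = T x" if "solves_monge X sq_dist_cost \<mu>\<^sub>0 \<mu>\<^sub>1 T'" for T'
  proof -
    have T': "T' \<in> transport_maps X \<mu>\<^sub>0 \<mu>\<^sub>1" "monge_cost sq_dist_cost \<mu>\<^sub>0 T' = kantorovich_cost sq_dist_cost \<Gamma>"
      using that by (auto simp: solves_monge_def mon)
    have m: "T' \<in> \<mu>\<^sub>0 \<rightarrow>\<^sub>M BX" "T \<in> \<mu>\<^sub>0 \<rightarrow>\<^sub>M BX" "(\<lambda>x. x) \<in> \<mu>\<^sub>0 \<rightarrow>\<^sub>M BX"
      using T'(1) T_meas sets_\<mu>0
      by (auto simp: transport_maps_def BX_def measurable_ident_sets cong: measurable_cong_sets)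
    have eq: "distr \<mu>\<^sub>0 (BX \<Otimes>\<^sub>M BX) (\<lambda>x. (x, T' x)) = \<Gamma>"
      using optimal(2)[OF plan(1)[OF T'(1)]] plan(2)[OF T'(1)] T'(2) by simp
    have P: "{p \<in> space (BX \<Otimes>\<^sub>M BX). snd p = T (fst p)} \<in> sets (BX \<Otimes>\<^sub>M BX)"
    proof (rule measurable_equality_set)
      show "snd \<in> borel_measurable (BX \<Otimes>\<^sub>M BX)"
        unfolding BX_def by (rule measurable_into_borel[OF measurable_snd])
      show "(\<lambda>p. T (fst p)) \<in> borel_measurable (BX \<Otimes>\<^sub>M BX)"
        using measurable_compose[OF measurable_fst T_meas]
        unfolding BX_def by (rule measurable_into_borel)
    qed
    have "AE p in \<Gamma>. snd p = T (fst p)"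
      unfolding \<Gamma>_def using m P by (subst AE_distr_iff) auto
    then show ?thesis
      unfolding eq[symmetric] using m P by (subst (asm) AE_distr_iff) auto
  qed
  have "(self_adjoint (\<pi> g) \<and> positive_definite (\<pi> g)) \<and>
       (solves_monge X sq_dist_cost \<mu>\<^sub>0 \<mu>\<^sub>1 T \<and>
        (\<forall>T'. solves_monge X sq_dist_cost \<mu>\<^sub>0 \<mu>\<^sub>1 T' \<longrightarrow> (AE x in \<mu>\<^sub>0. T' x = T x))) \<and>
       (solves_kantorovich X sq_dist_cost \<mu>\<^sub>0 \<mu>\<^sub>1 \<Gamma> \<and>
        (\<forall>\<Gamma>'. solves_kantorovich X sq_dist_cost \<mu>\<^sub>0 \<mu>\<^sub>1 \<Gamma>' \<longrightarrow> \<Gamma>' = \<Gamma>)) \<and>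
       orbit_cost G \<alpha> \<rho> sq_dist_cost g\<^sub>0 g\<^sub>1 h = orbit_transport G X \<alpha> \<rho> sq_dist_cost g\<^sub>0 g\<^sub>1 \<and>
       (kantorovich X sq_dist_cost \<mu>\<^sub>0 \<mu>\<^sub>1 = monge X sq_dist_cost \<mu>\<^sub>0 \<mu>\<^sub>1 \<and>
        monge X sq_dist_cost \<mu>\<^sub>0 \<mu>\<^sub>1 = orbit_transport G X \<alpha> \<rho> sq_dist_cost g\<^sub>0 g\<^sub>1)"
    using spd' T_tm \<Gamma>_C uniq_map uniq_plan
    by (auto simp: solves_monge_def solves_kantorovich_def kan mon orb orbit_h cost_T)
  then show ?thesis
    using h k unfolding Let_def g_def T_def \<Gamma>_def BX_def K_def by blast
qed

end
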